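(* Let $\mathbf T$ be a troupe, and let $f_1,\ldots,f_r$ be insertion-additive tree statistics. For every permutation $\pi$, we have \[\sum_{\mathcal T\in\mathcal P^{-1}(\pi)\cap\mathsf D\mathbf T}x_1^{\ddot f_1(\mathcal T)}\cdots x_r^{\ddot f_r(\mathcal T)}=\sum_{\mathcal H\in\mathrm{VHC}(\pi)}\mathbf G_{\mathbf q^{\mathcal H}}(x_1,\ldots,x_r),\] where \[\mathbf G_{\mathbf q^{\mathcal H}}(x_1,\ldots,x_r)=\prod_{t=0}^k\mathbf G_{q_t}(x_1,\ldots,x_r)=\prod_{t=0}^k\sum_{T\in\mathbf T_{q_t}}x_1^{f_1(T)}\cdots x_r^{f_r(T)}\] when $\mathbf q^{\mathcal H}=(q_0,\ldots,q_k)$.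
   Context: Trees and troupes. Fix a finite set $\mathbf C$ of colors containing black and white. A binary plane tree is a finite (possibly empty) rooted tree in which every vertex has at most two children, every child is designated as either a left child or a right child (not both), and no vertex has two left children or two right children. A colored binary plane tree is a binary plane tree together with a function from its vertex set to $\mathbf C$; trees are considered up to isomorphism, and $\mathsf{CBPT}$ is the set of colored binary plane trees. For $\mathbf T\subseteq\mathsf{CBPT}$, $\mathbf T_n$ is the set of trees in $\mathbf T$ with $n$ vertices. Insertion: for nonempty $T_1,T_2\in\mathsf{CBPT}$ and a vertex $v$ of $T_1$, replace $v$ by two vertices joined by a left edge: the lower one is still called $v$ (it keeps the color and the left/right subtrees of $v$), and the upper one $v^*$ is black, takes the place of $v$ with respect to the parent of $v$ (if any), and has $v$ as left child; then attach $T_2$ as the right subtree of $v^*$. The result is $\nabla_v(T_1,T_2)$. Decomposition: if $v^*$ is a black vertex with $2$ children in $T$, let $v$ be its left child and $T_2$ its right subtree; delete $T_2$ and contract the edge $vv^*$ to a single vertex identified with $v$ (with the color of $v$), giving $T_1$; then $\Delta_{v^*}(T)=(T_1,T_2)$. A troupe is a set $\mathbf T\subseteq\mathsf{CBPT}$ such that: (i) $\nabla_v(T_1,T_2)\in\mathbf T$ for all nonempty $T_1,T_2\in\mathbf T$ and all vertices $v$ of $T_1$; (ii) $\Delta_{v^*}(T)\in\mathbf T\times\mathbf T$ for every $T\in\mathbf T$ and every black vertex $v^*$ of $T$ with $2$ children; (iii) for every $T\in\mathbf T$, all vertices of $T$ with $2$ children are black. Statistics. A tree statistic is a function $f:\mathsf{CBPT}\to\mathbb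 C$; it is insertion-additive if $f(\nabla_v(T_1,T_2))=f(T_1)+f(T_2)$ for all nonempty $T_1,T_2$ and all vertices $v$ of $T_1$. Here $x_1,\dots,x_r$ are variables and monomials are commuting formal powers with $x_i^ax_i^b=x_i^{a+b}$. Put $\mathbf G_n(x_1,\ldots,x_r)=\sum_{T\in\mathbf T_n}x_1^{f_1(T)}\cdots x_r^{f_r(T)}$. Decreasing trees and postorder. A decreasing colored binary plane tree is a colored binary plane tree whose vertices are bijectively labeled by a finite set of positive integers such that each nonroot vertex has a smaller label than its parent. $\mathrm{skel}(\mathcal T)$ is the tree obtained by removing labels. $\mathsf D\mathbf T$ is the set of decreasing colored binary plane trees whose skeleton lies in $\mathbf T$, and $\ddot f(\mathcal T)=f(\mathrm{skel}(\mathcal T))$. The postorder reading is defined by: $\mathcal P$ of the empty tree is the empty permutation, and $\mathcal P(\mathcal T)=\mathcal P(\mathcal T_L)\,\mathcal P(\mathcal T_R)\,m$ if $\mathcal T$ has root label $m$ and left and right subtrees $\mathcal T_L,\mathcal T_R$. Valid hook configurations. A permutation is an ordering $\pi=\pi_1\cdots\pi_n$ of a finite set of positive integers; a descent is an index $i\in\{1,\dots,n-1\}$ with $\pi_i>\pi_{i+1}$; the plot of $\pi$ is the set of points $(i,\pi_i)$. A hook of $\pi$ with southwest endpoint $(i,\pi_i)$ and northeast endpoint $(j,\pi_j)$, where $i<j$ and $\pi_i<\pi_j$, is the union of the vertical segment from $(i,\pi_i)$ to $(i,\pi_j)$ and the horizontal segment from $(i,\pi_j)$ to $(j,\pi_j)$.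 If $d_1<\cdots<d_k$ are the descents of $\pi$, a valid hook configuration of $\pi$ is a tuple $\mathcal H=(H_1,\ldots,H_k)$ of hooks of $\pi$ such that: (1) the southwest endpoint of $H_i$ is $(d_i,\pi_{d_i})$ for each $i$; (2) no point of the plot lies directly above a hook (i.e. if $H_m$ has northeast endpoint $(j_m,\pi_{j_m})$, then $\pi_x<\pi_{j_m}$ for all $d_m<x<j_m$); (3) no two hooks intersect or overlap unless the northeast endpoint of one is the southwest endpoint of the other. $\mathrm{VHC}(\pi)$ is the set of valid hook configurations of $\pi$; if $\pi$ has no descents (including when $\pi$ is empty), it consists of the single empty configuration. Coloring and $\mathbf q^{\mathcal H}$. Given $\mathcal H=(H_1,\dots,H_k)\in\mathrm{VHC}(\pi)$ with $H_m$ having northeast endpoint $(j_m,\pi_{j_m})$, give the hooks distinct colors and the "sky" another color (blue). Northeast endpoints of hooks are uncolored. Any other point $(i,\pi_i)$ looks straight up (a southwest endpoint of a hook looks around the left side of that hook's vertical part, so it does not see that hook) and gets the color of the first hook it sees, or blue if it sees no hook; that is, it gets the color of the hook $H_m$ with $d_m<i<j_m$ for which $\pi_{j_m}$ is smallest, or blue if there is no such $m$. Let $q_0$ be the number of blue points and, for $1\le i\le k$, $q_i$ the number of points with the same color as $H_i$; $\mathbf q^{\mathcal H}=(q_0,\ldots,q_k)$. *)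

theory Defs
  imports Complex_Main "HOL-Library.Tree" "HOL-Library.Poly_Mapping"
begin

section \<open>Colored binary plane trees\<close>

text \<open>A colored binary plane tree is a term of type \<open>'c tree\<close>, where the finite type \<open>'c\<close> is the set of
  colors. A vertex is named by the path leading to it from the root.\<close>

datatype side = Lft | Rgt

fun subtree_at :: "'a tree \<Rightarrow> side list \<Rightarrow> 'a tree" where
  "subtree_at t [] = t"
| "subtree_at Leaf (s # p) = Leaf"
| "subtree_at (Node l a r) (Lft # p) = subtree_at l p"
| "subtree_at (Node l a r) (Rgt # p) = subtree_at r p"

fun replace_at :: "side list \<Rightarrow> 'a tree \<Rightarrow> 'a tree \<Rightarrow> 'a tree" where
  "replace_at [] s t = s"
| "replace_at (d # p) s Leaf = Leaf"
| "replace_at (Lft # p) s (Node l a r) = Node (replace_at p s l) a r"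
| "replace_at (Rgt # p) s (Node l a r) = Node l a (replace_at p s r)"

definition vertices :: "'a tree \<Rightarrow> side list set" where
  "vertices t = {p. subtree_at t p \<noteq> Leaf}"

definition label_at :: "'a tree \<Rightarrow> side list \<Rightarrow> 'a" where
  "label_at t p = value (subtree_at t p)"

definition two_children :: "'a tree \<Rightarrow> side list \<Rightarrow> bool" where
  "two_children t p \<longleftrightarrow> p @ [Lft] \<in> vertices t \<and> p @ [Rgt] \<in> vertices t"

text \<open>Insertion: the subtree of \<open>t1\<close> rooted at \<open>v\<close> is pushed down to become the left subtree of the new
  black vertex, whose right subtree is \<open>t2\<close>.\<close>

definition insertion :: "'c \<Rightarrow> side list \<Rightarrow> 'c tree \<Rightarrow> 'c tree \<Rightarrow> 'c tree" where
  "insertion black v t1 t2 = replace_at v (Node (subtree_at t1 v) black t2) t1"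

text \<open>Decomposition at \<open>w\<close>: deleting the right subtree of \<open>w\<close> and contracting the edge from \<open>w\<close> to its
  left child puts the left subtree of \<open>w\<close> in the place of \<open>w\<close>.\<close>

definition decomposition :: "side list \<Rightarrow> 'c tree \<Rightarrow> 'c tree \<times> 'c tree" where
  "decomposition w t = (replace_at w (subtree_at t (w @ [Lft])) t, subtree_at t (w @ [Rgt]))"

definition troupe :: "'c \<Rightarrow> 'c tree set \<Rightarrow> bool" where
  "troupe black T \<longleftrightarrow>
     (\<forall>t1\<in>T. \<forall>t2\<in>T. t1 \<noteq> Leaf \<longrightarrow> t2 \<noteq> Leaf \<longrightarrow>
        (\<forall>v\<in>vertices t1. insertion black v t1 t2 \<in> T)) \<and>
     (\<forall>t\<in>T. \<forall>w\<in>vertices t. label_at t w = black \<longrightarrow> two_children t w \<longrightarrow>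
        decomposition w t \<in> T \<times> T) \<and>
     (\<forall>t\<in>T. \<forall>w\<in>vertices t. two_children t w \<longrightarrow> label_at t w = black)"

section \<open>Tree statistics and generating functions\<close>

definition insertion_additive :: "'c \<Rightarrow> ('c tree \<Rightarrow> complex) \<Rightarrow> bool" where
  "insertion_additive black f \<longleftrightarrow>
     (\<forall>t1 t2. t1 \<noteq> Leaf \<longrightarrow> t2 \<noteq> Leaf \<longrightarrow>
        (\<forall>v\<in>vertices t1. f (insertion black v t1 t2) = f t1 + f t2))"

text \<open>Generalized polynomials with integer coefficients: finite formal linear combinations of monomials
  in variables indexed by \<^typ>\<open>nat\<close> with complex exponents. The product of
  \<^type>\<open>poly_mapping\<close> is the convolution, i.e. exponents are added (see \<open>xpow_add\<close>).\<close>

type_synonym gpoly = "(nat \<Rightarrow>\<^sub>0 complex) \<Rightarrow>\<^sub>0 int"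

definition xpow :: "nat \<Rightarrow> complex \<Rightarrow> gpoly" where
  "xpow i a = Poly_Mapping.single (Poly_Mapping.single i a) 1"

lemma xpow_add: "xpow i a * xpow i b = xpow i (a + b)"
  by (simp add: xpow_def mult_single single_add)

lemma xpow_0: "xpow i 0 = 1"
  by (simp add: xpow_def)

definition GF :: "'c tree set \<Rightarrow> nat \<Rightarrow> (nat \<Rightarrow> 'c tree \<Rightarrow> complex) \<Rightarrow> nat \<Rightarrow> gpoly" where
  "GF T r f n = (\<Sum>t\<in>{t\<in>T. size t = n}. \<Prod>i=1..r. xpow i (f i t))"

definition GF_seq :: "'c tree set \<Rightarrow> nat \<Rightarrow> (nat \<Rightarrow> 'c tree \<Rightarrow> complex) \<Rightarrow> nat list \<Rightarrow> gpoly" where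
  "GF_seq T r f qs = (\<Prod>t<length qs. GF T r f (qs ! t))"

section \<open>Decreasing trees\<close>

definition skel :: "('c \<times> nat) tree \<Rightarrow> 'c tree" where
  "skel = map_tree fst"

definition decreasing :: "('c \<times> nat) tree \<Rightarrow> bool" where
  "decreasing t \<longleftrightarrow>
     inj_on (\<lambda>p. snd (label_at t p)) (vertices t) \<and>
     (\<forall>p\<in>vertices t. snd (label_at t p) > 0) \<and>
     (\<forall>p d. p @ [d] \<in> vertices t \<longrightarrow> snd (label_at t (p @ [d])) < snd (label_at t p))"

definition decreasing_over :: "'c tree set \<Rightarrow> ('c \<times> nat) tree set" where
  "decreasing_over T = {t. decreasing t \<and> skel t \<in> T}"

definition ddot :: "('c tree \<Rightarrow> complex) \<Rightarrow> ('c \<times> nat) tree \<Rightarrow> complex" where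
  "ddot f t = f (skel t)"

definition postorder_reading :: "('c \<times> nat) tree \<Rightarrow> nat list" where
  "postorder_reading t = postorder (map_tree snd t)"

section \<open>Valid hook configurations\<close>

text \<open>Positions in a permutation are counted from 0, so its plot consists of the points
  \<open>(i, \<pi> ! i)\<close> with \<open>i < length \<pi>\<close>.\<close>

definition is_perm :: "nat list \<Rightarrow> bool" where
  "is_perm \<pi> \<longleftrightarrow> distinct \<pi> \<and> (\<forall>x\<in>set \<pi>. x > 0)"

definition descents :: "nat list \<Rightarrow> nat list" where
  "descents \<pi> = filter (\<lambda>i. \<pi> ! i > \<pi> ! Suc i) [0..<length \<pi> - 1]"

text \<open>A hook is recorded by the positions \<open>(i, j)\<close> of its southwest and northeast endpoints;
  \<open>hook_curve\<close> is the corresponding subset of the plane.\<close>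

definition is_hook :: "nat list \<Rightarrow> nat \<times> nat \<Rightarrow> bool" where
  "is_hook \<pi> h \<longleftrightarrow> fst h < snd h \<and> snd h < length \<pi> \<and> \<pi> ! fst h < \<pi> ! snd h"

definition hook_curve :: "nat list \<Rightarrow> nat \<times> nat \<Rightarrow> (real \<times> real) set" where
  "hook_curve \<pi> h =
     {real (fst h)} \<times> {real (\<pi> ! fst h)..real (\<pi> ! snd h)} \<union>
     {real (fst h)..real (snd h)} \<times> {real (\<pi> ! snd h)}"

definition VHC :: "nat list \<Rightarrow> (nat \<times> nat) list set" where
  "VHC \<pi> = {H. (\<forall>h\<in>set H. is_hook \<pi> h) \<and>
     map fst H = descents \<pi> \<and>
     (\<forall>h\<in>set H. \<forall>x. fst h < x \<and> x < snd h \<longrightarrow> \<pi> ! x < \<pi> ! snd h) \<and>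
     (\<forall>m<length H. \<forall>m'<length H. m \<noteq> m' \<longrightarrow>
        hook_curve \<pi> (H ! m) \<inter> hook_curve \<pi> (H ! m') = {} \<or>
        snd (H ! m) = fst (H ! m') \<or> snd (H ! m') = fst (H ! m))}"

definition northeast :: "(nat \<times> nat) list \<Rightarrow> nat set" where
  "northeast H = snd ` set H"

definition under :: "(nat \<times> nat) list \<Rightarrow> nat \<Rightarrow> nat \<Rightarrow> bool" where
  "under H i m \<longleftrightarrow> m < length H \<and> fst (H ! m) < i \<and> i < snd (H ! m)"

text \<open>\<open>sees \<pi> H i m\<close>: the lowest hook above position \<open>i\<close> is \<open>H ! m\<close>. For a valid hook configuration
  there is at most one such \<open>m\<close>, since distinct hooks have distinct northeast endpoints.\<close>

definition sees :: "nat list \<Rightarrow> (nat \<times> nat) list \<Rightarrow> nat \<Rightarrow> nat \<Rightarrow> bool" where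
  "sees \<pi> H i m \<longleftrightarrow> under H i m \<and>
     (\<forall>m'. under H i m' \<longrightarrow> \<pi> ! snd (H ! m) \<le> \<pi> ! snd (H ! m'))"

text \<open>The entry at index 0 counts the blue points, the one at index \<open>m + 1\<close> those with the color of
  \<open>H ! m\<close>.\<close>

definition color_counts :: "nat list \<Rightarrow> (nat \<times> nat) list \<Rightarrow> nat list" where
  "color_counts \<pi> H =
     card {i. i < length \<pi> \<and> i \<notin> northeast H \<and> (\<forall>m. \<not> under H i m)} #
     map (\<lambda>m. card {i. i < length \<pi> \<and> i \<notin> northeast H \<and> sees \<pi> H i m}) [0..<length H]"

section \<open>All sums involved are finite\<close>

lemma finite_trees_bounded:
  assumes "finite A"
  shows "finite {t. set_tree t \<subseteq> A \<and> size t \<le> n}"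
proof (induction n)
  case 0
  have "{t :: 'a tree. set_tree t \<subseteq> A \<and> size t \<le> 0} \<subseteq> {Leaf}"
    by (auto simp: eq_size_0)
  then show ?case
    by (rule finite_subset) simp
next
  case (Suc n)
  let ?B = "{t. set_tree t \<subseteq> A \<and> size t \<le> n}"
  have "{t. set_tree t \<subseteq> A \<and> size t \<le> Suc n}
          \<subseteq> insert Leaf ((\<lambda>(l, a, r). Node l a r) ` (?B \<times> A \<times> ?B))"
  proof
    fix t assume "t \<in> {t. set_tree t \<subseteq> A \<and> size t \<le> Suc n}"
    then show "t \<in> insert Leaf ((\<lambda>(l, a, r). Node l a r) ` (?B \<times> A \<times> ?B))"
      by (cases t) (auto simp: image_iff)
  qed
  then show ?case
    by (rule finite_subset) (use Suc assms in auto)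
qed

lemma finite_trees_of_size:
  fixes T :: "'c::finite tree set"
  shows "finite {t\<in>T. size t = n}"
  by (rule finite_subset[OF _ finite_trees_bounded[of UNIV n]]) auto

lemma finite_postorder_fiber:
  fixes T :: "'c::finite tree set"
  shows "finite {t\<in>decreasing_over T. postorder_reading t = \<pi>}"
proof (rule finite_subset[OF _ finite_trees_bounded[of "UNIV \<times> set \<pi>" "length \<pi>"]])
  have *: "snd ` set_tree t = set (postorder_reading t)" for t :: "('c \<times> nat) tree"
    by (simp add: postorder_reading_def tree.set_map)
  have "size t = length (postorder_reading t)" for t :: "('c \<times> nat) tree"
    by (simp add: postorder_reading_def)
  with * show "{t\<in>decreasing_over T. postorder_reading t = \<pi>}
      \<subseteq> {t. set_tree t \<subseteq> UNIV \<times> set \<pi> \<and> size t \<le> length \<pi>}"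
    by force
qed simp

lemma finite_VHC: "finite (VHC \<pi>)"
proof (rule finite_subset)
  let ?N = "{..<length \<pi>} \<times> {..<length \<pi>}"
  show "VHC \<pi> \<subseteq> {H. set H \<subseteq> ?N \<and> length H = length (descents \<pi>)}"
  proof
    fix H assume H: "H \<in> VHC \<pi>"
    have "map fst H = descents \<pi>" and hooks: "\<forall>h\<in>set H. is_hook \<pi> h"
      using H unfolding VHC_def by blast+
    then have "length H = length (descents \<pi>)"
      by (metis length_map)
    moreover have "h \<in> ?N" if "h \<in> set H" for h
      using hooks that by (cases h) (auto simp: is_hook_def)
    ultimately show "H \<in> {H. set H \<subseteq> ?N \<and> length H = length (descents \<pi>)}"
      by blast
  qed
  show "finite {H. set H \<subseteq> ?N \<and> length H = length (descents \<pi>)}"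
    by (rule finite_lists_length_eq) simp
qed

end

theory Submission
  imports Defs
begin

text \<open>Both sides of the identity satisfy the same recursion on the permutation.  The link is that a descent
in the postorder reading of a decreasing tree forces a vertex with two children: if the letter \<open>d\<close> is
followed by a smaller one, then \<open>d\<close> is a left child, and the smaller letter begins the subtree of its
right sibling (\<open>descent_is_graft\<close>).  The parent \<open>j\<close> of \<open>d\<close> is read after both subtrees and is larger than
everything in them, just like the northeast endpoint of a hook that starts at \<open>d\<close>.  In a troupe the
vertex \<open>j\<close> is black, so decomposing there yields two trees of the troupe.  One of them reads the part
of the permutation strictly under the hook from \<open>d\<close> to \<open>j\<close>; the other one reads what remains outside
the hook once \<open>j\<close> is dropped.

To reverse this by an insertion, the new vertex \<open>j\<close> must be smaller than its parent.  That is automatic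
if \<open>d\<close> is the descent with the largest entry: the entries exceeding it form an increasing run at the
end of the permutation, and all candidates for \<open>j\<close> lie in that run (locale \<open>tail_bound_descent\<close>).  Since
the statistics are insertion-additive, their monomials multiply, which gives
\<open>F(P) = (\<Sum>j. F(outer) * F(inner))\<close>, where \<open>F\<close> is the sum over trees (\<open>tree_sum_rec\<close>).

For the same \<open>d\<close>, a valid hook configuration consists of a hook from \<open>d\<close> to some \<open>j\<close> in the tail together
with a configuration of the outer and one of the inner part, chosen independently
(\<open>hook_config_bij\<close>).  The point colors are compatible with this: the points that are blue in the inner
part become those colored by the hook at \<open>d\<close>, and no other color class changes (\<open>config_weight_glue\<close>).  So
the sum over configurations satisfies the same recursion (\<open>hook_sum_rec\<close>).  When there is no descent,
each tree shape has exactly one admissible labelling and there is only the empty configuration, for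
which all points are blue; both sides are then the generating function of the trees with as many
vertices as there are entries.\<close>

section \<open>Insertion and decomposition are inverse to each other\<close>

lemma map_tree_replace_at:
  "map_tree g (replace_at p s t) = replace_at p (map_tree g s) (map_tree g t)"
  by (induction p s t rule: replace_at.induct) auto

lemma map_tree_subtree_at: "map_tree g (subtree_at t p) = subtree_at (map_tree g t) p"
  by (induction t p rule: subtree_at.induct) auto

lemma skel_insertion:
  "skel (insertion x p t s) = insertion (fst x) p (skel t) (skel s)"
  by (simp add: skel_def insertion_def map_tree_replace_at map_tree_subtree_at)

lemma vertices_skel [simp]: "vertices (skel t) = vertices t"
  by (auto simp: vertices_def skel_def simp flip: map_tree_subtree_at)

lemma subtree_at_replace_at:
  "p \<in> vertices t \<Longrightarrow> subtree_at (replace_at p s t) (p @ q) = subtree_at s q"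
  by (induction p s t rule: replace_at.induct) (auto simp: vertices_def)

lemma replace_at_twice: "replace_at p s (replace_at p s' t) = replace_at p s t"
  by (induction p s t rule: replace_at.induct) auto

lemma replace_at_self: "replace_at p (subtree_at t p) t = t"
  by (induction t p rule: subtree_at.induct) auto

lemma decomposition_insertion:
  assumes "p \<in> vertices t"
  shows "decomposition p (insertion b p t s) = (t, s)"
  using assms
  by (simp add: decomposition_def insertion_def subtree_at_replace_at replace_at_twice
      replace_at_self)

lemma inserted_vertex:
  assumes "p \<in> vertices t" and "s \<noteq> Leaf"
  shows "p \<in> vertices (insertion b p t s)"
    and "two_children (insertion b p t s) p"
    and "label_at (insertion b p t s) p = b"
  using assms subtree_at_replace_at[OF assms(1), where q = "[]"]
  by (auto simp: vertices_def two_children_def label_at_def insertion_def subtree_at_replace_at)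

text \<open>The three troupe axioms amount to one equivalence: a vertex with two children must be black, and
decomposing there undoes an insertion.  This is the only way in which the troupe enters the proof.\<close>

lemma troupe_insertion_iff:
  assumes T: "troupe black T" and "p \<in> vertices t" and "s \<noteq> Leaf"
  shows "insertion c p t s \<in> T \<longleftrightarrow> c = black \<and> t \<in> T \<and> s \<in> T"
proof
  assume "c = black \<and> t \<in> T \<and> s \<in> T"
  moreover have "t \<noteq> Leaf"
    using assms(2) by (cases p) (auto simp: vertices_def)
  ultimately show "insertion c p t s \<in> T"
    using assms unfolding troupe_def by blast
next
  assume *: "insertion c p t s \<in> T"
  note iv = inserted_vertex[OF assms(2,3), of c]
  have "c = black"
    using T * iv unfolding troupe_def by metis
  moreover have "decomposition p (insertion c p t s) \<in> T \<times> T"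
    using T * iv \<open>c = black\<close> unfolding troupe_def by metis
  ultimately show "c = black \<and> t \<in> T \<and> s \<in> T"
    using decomposition_insertion[OF assms(2)] by simp
qed

section \<open>Labelled trees in postorder\<close>

lemma postorder_reading_simps [simp]:
  "postorder_reading Leaf = []"
  "postorder_reading (Node l a r) = postorder_reading l @ postorder_reading r @ [snd a]"
  by (simp_all add: postorder_reading_def)

abbreviation labels :: "('c \<times> nat) tree \<Rightarrow> nat set" where
  "labels t \<equiv> set (postorder_reading t)"

text \<open>In the recursion the label of a vertex is a position of the permutation, not an entry, and the function
\<open>v\<close> turns positions into entries.  Sub-permutations are then just subsets of positions, and cutting a
permutation into pieces needs no renumbering.\<close>

fun heap_ordered :: "(nat \<Rightarrow> nat) \<Rightarrow> ('c \<times> nat) tree \<Rightarrow> bool" where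
  "heap_ordered v Leaf = True"
| "heap_ordered v (Node l a r) \<longleftrightarrow>
     (\<forall>x\<in>labels l \<union> labels r. v x < v (snd a)) \<and> heap_ordered v l \<and> heap_ordered v r"

section \<open>Grafting at a label\<close>

text \<open>Insertion at the vertex with label \<open>d\<close>.  Addressing the vertex by its label instead of by a path makes
the function structurally recursive and lets the postorder reading be followed through it.  If \<open>d\<close>
labels exactly one vertex, \<open>graft_eq_insertion\<close> gives the path.\<close>

fun graft :: "nat \<Rightarrow> 'c \<times> nat \<Rightarrow> ('c \<times> nat) tree \<Rightarrow> ('c \<times> nat) tree \<Rightarrow> ('c \<times> nat) tree" where
  "graft d x s Leaf = Leaf"
| "graft d x s (Node l a r) =
     (if snd a = d then Node (Node l a r) x s else Node (graft d x s l) a (graft d x s r))"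

lemma graft_absent: "d \<notin> labels t \<Longrightarrow> graft d x s t = t"
  by (induction t) auto

lemma labels_graft:
  "labels (graft d x s t) =
     labels t \<union> (if d \<in> labels t then insert (snd x) (labels s) else {})"
  by (induction t) (auto simp: graft_absent)

lemma graft_eq_insertion:
  assumes "d \<in> labels t" and "distinct (postorder_reading t)"
  shows "\<exists>p\<in>vertices t. \<forall>x s. graft d x s t = insertion x p t s"
  using assms
proof (induction t)
  case (Node l a r)
  consider "snd a = d" | "snd a \<noteq> d" "d \<in> labels l" "d \<notin> labels r"
    | "snd a \<noteq> d" "d \<notin> labels l" "d \<in> labels r"
    using Node.prems by auto
  then show ?case
  proof cases
    case 1
    then show ?thesis
      by (intro bexI[of _ "[]"]) (auto simp: insertion_def vertices_def)
  next
    case 2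
    with Node obtain p where "p \<in> vertices l" "\<forall>x s. graft d x s l = insertion x p l s"
      by auto
    with 2 show ?thesis
      by (intro bexI[of _ "Lft # p"]) (auto simp: insertion_def vertices_def graft_absent)
  next
    case 3
    with Node obtain p where "p \<in> vertices r" "\<forall>x s. graft d x s r = insertion x p r s"
      by auto
    with 3 show ?thesis
      by (intro bexI[of _ "Rgt # p"]) (auto simp: insertion_def vertices_def graft_absent)
  qed
qed simp

text \<open>Grafting puts the postorder word of \<open>s\<close>, followed by \<open>j\<close>, directly after the letter \<open>d\<close>.  So the
reading stays increasing exactly because the new labels fill the gap of \<open>t\<close> behind \<open>d\<close>.\<close>

lemma sorted_graft:
  assumes "sorted_wrt (<) (postorder_reading t)" and "sorted_wrt (<) (postorder_reading s)"
    and "\<forall>y\<in>labels t. y \<le> d \<or> j < y" and "\<forall>y\<in>labels s. d < y \<and> y < j" and "d < j"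
  shows "sorted_wrt (<) (postorder_reading (graft d (c, j) s t))"
  using assms(1,3)
proof (induction t)
  case (Node l a r)
  have ord: "\<forall>x\<in>labels l. \<forall>y\<in>labels r. x < y" "\<forall>x\<in>labels l. x < snd a" "\<forall>x\<in>labels r. x < snd a"
    using Node.prems(1) by (auto simp: sorted_wrt_append)
  have IH: "sorted_wrt (<) (postorder_reading (graft d (c, j) s l))"
    "sorted_wrt (<) (postorder_reading (graft d (c, j) s r))"
    using Node by (auto simp: sorted_wrt_append)
  have mem: "\<forall>y\<in>labels l \<union> labels r \<union> {snd a}. y \<le> d \<or> j < y"
    using Node.prems(2) by auto
  show ?case
  proof (cases "snd a = d")
    case True
    have "x < y" if "x \<in> labels l \<union> labels r \<union> {d}" "y \<in> labels s \<union> {j}" for x y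
    proof -
      have "x \<le> d" using that(1) ord True by auto
      moreover have "d < y" using that(2) assms(4,5) by auto
      ultimately show ?thesis by simp
    qed
    then show ?thesis
      using True Node.prems(1) assms(2,4) by (auto simp: sorted_wrt_append)
  next
    case False
    have new: "x = j \<or> x \<in> labels s \<Longrightarrow> d < x \<and> x \<le> j" for x
      using assms(4,5) by auto
    have gl: "x < y" if "x \<in> labels (graft d (c, j) s l)" "y \<in> labels r \<union> {snd a}" for x y
    proof (cases "x \<in> labels l")
      case True
      then show ?thesis using that(2) ord by auto
    next
      case x: False
      then have "d \<in> labels l" "d < x" "x \<le> j"
        using that(1) new[of x] by (auto simp: labels_graft split: if_splits)
      then have "d < y" using that(2) ord by auto
      then have "j < y" using mem that(2) by (metis Un_iff linorder_not_less)
      then show ?thesis using \<open>x \<le> j\<close> by simp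
    qed
    have gr: "x < snd a" if "x \<in> labels (graft d (c, j) s r)" for x
    proof (cases "x \<in> labels r")
      case True
      then show ?thesis using ord by auto
    next
      case x: False
      then have "d \<in> labels r" "d < x" "x \<le> j"
        using that new[of x] by (auto simp: labels_graft split: if_splits)
      then show ?thesis using mem ord by fastforce
    qed
    have gm: "x < y" if "x \<in> labels (graft d (c, j) s l)" "y \<in> labels (graft d (c, j) s r)" for x y
    proof (cases "y \<in> labels r")
      case True
      then show ?thesis using gl that(1) by auto
    next
      case y: False
      then have "d \<in> labels r" "d < y"
        using that(2) new[of y] by (auto simp: labels_graft split: if_splits)
      moreover from this have "x < d" using gl that(1) by auto
      ultimately show ?thesis by simp
    qed
    show ?thesis
      using False IH gl gr gm by (simp add: sorted_wrt_append)
  qed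
qed simp

text \<open>The ancestors of the vertex \<open>d\<close> come later in postorder.  Hence it is enough that \<open>j\<close> has a smaller
value than everything that comes after \<open>d\<close>.  This is where grafting could fail for an arbitrary descent
\<open>d\<close>, and why a special one is chosen below.\<close>

lemma heap_ordered_graft:
  assumes "heap_ordered v t" and "heap_ordered v s"
    and "sorted_wrt (<) (postorder_reading t)"
    and "\<forall>y\<in>labels t. d < y \<longrightarrow> v j < v y" and "\<forall>y\<in>labels s. v y < v j" and "v d < v j"
  shows "heap_ordered v (graft d (c, j) s t)"
  using assms(1,3,4)
proof (induction t)
  case (Node l a r)
  have IH: "heap_ordered v (graft d (c, j) s l)" "heap_ordered v (graft d (c, j) s r)"
    using Node by (auto simp: sorted_wrt_append)
  have root: "\<forall>x\<in>labels l \<union> labels r. v x < v (snd a)"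
    using Node.prems(1) by simp
  show ?case
  proof (cases "snd a = d")
    case True
    then have "\<forall>x\<in>labels (Node l a r). v x < v j"
      using root assms(6) by (auto intro: less_trans)
    then show ?thesis
      using True Node.prems(1) assms(2,5) by auto
  next
    case False
    have "v x < v (snd a)" if "x \<in> labels (graft d (c, j) s l) \<union> labels (graft d (c, j) s r)" for x
    proof (cases "x \<in> labels l \<union> labels r")
      case x: False
      then have "d \<in> labels l \<union> labels r" "v x \<le> v j"
        using that assms(5) by (auto simp: labels_graft less_imp_le split: if_splits)
      moreover from this have "d < snd a"
        using Node.prems(2) by (auto simp: sorted_wrt_append)
      ultimately show ?thesis
        using Node.prems(3) by fastforce
    qed (use root in blast)
    then show ?thesis
      using False IH by simp
  qed
qed simp

text \<open>Unless the new vertex is also called \<open>d\<close>, the root after grafting is not \<open>d\<close>, which tells the two kinds of recursion step apart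
when a graft is undone.\<close>

lemma root_graft:
  assumes "graft d x s t = Node l a r" and "snd x \<noteq> d"
  shows "snd a \<noteq> d"
  using assms by (cases t) (auto split: if_splits)

lemma graft_inject:
  assumes "graft d x s t = graft d x' s' t'"
    and "d \<in> labels t" and "d \<in> labels t'" and "snd x \<noteq> d" and "snd x' \<noteq> d"
    and "distinct (postorder_reading t)" and "distinct (postorder_reading t')"
  shows "x = x' \<and> s = s' \<and> t = t'"
  using assms
proof (induction t arbitrary: t')
  case (Node l a r)
  obtain l' a' r' where t': "t' = Node l' a' r'"
    using Node.prems by (cases t') auto
  consider "snd a = d" "snd a' = d" | "snd a = d" "snd a' \<noteq> d" | "snd a \<noteq> d" "snd a' = d"
    | "snd a \<noteq> d" "snd a' \<noteq> d" by blast
  then show ?case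
  proof cases
    case 1
    then show ?thesis using Node.prems t' by auto
  next
    case 2
    then have "graft d x' s' l' = Node l a r"
      using Node.prems t' by auto
    then show ?thesis
      using root_graft 2 Node.prems by metis
  next
    case 3
    then have "graft d x s l = Node l' a' r'"
      using Node.prems t' by auto
    then show ?thesis
      using root_graft 3 Node.prems by metis
  next
    case 4
    then have eq: "graft d x s l = graft d x' s' l'" "a = a'" "graft d x s r = graft d x' s' r'"
      using Node.prems t' by auto
    show ?thesis
    proof (cases "d \<in> labels l")
      case True
      then have r: "d \<notin> labels r" using Node.prems by auto
      then have "d \<notin> labels r'"
        using eq(3) by (metis UnI1 graft_absent labels_graft)
      then show ?thesis
        using Node r True 4 t' eq by (auto simp: graft_absent)
    next
      case False
      then have r: "d \<in> labels r" using Node.prems 4 by auto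
      have "d \<notin> labels l'"
        using eq(1) False by (metis UnI1 graft_absent labels_graft)
      then show ?thesis
        using Node r False 4 t' eq by (auto simp: graft_absent)
    qed
  qed
qed simp

text \<open>Let \<open>e\<close> follow \<open>d\<close> directly in postorder, with a smaller value.  Then \<open>e\<close> is not the parent of \<open>d\<close>, and the
only other possibility is that \<open>d\<close> is a left child whose sibling subtree begins with \<open>e\<close>.  So a descent
of the postorder reading singles out a vertex with two children, namely the parent \<open>j\<close> of \<open>d\<close>.\<close>

lemma descent_is_graft:
  assumes "sorted_wrt (<) (postorder_reading t)" and "heap_ordered v t"
    and "d \<in> labels t" and "e \<in> labels t" and "d < e" and "v e < v d"
    and "\<forall>x\<in>labels t. \<not> (d < x \<and> x < e)"
  shows "\<exists>c j s u. t = graft d (c, j) s u \<and> d \<in> labels u \<and> s \<noteq> Leaf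
      \<and> sorted_wrt (<) (postorder_reading u) \<and> sorted_wrt (<) (postorder_reading s)
      \<and> heap_ordered v u \<and> heap_ordered v s
      \<and> (\<forall>y\<in>labels u. y \<le> d \<or> j < y) \<and> (\<forall>y\<in>labels s. d < y \<and> y < j) \<and> d < j \<and> v d < v j"
  using assms
proof (induction t)
  case (Node l a r)
  have ord: "\<forall>x\<in>labels l. \<forall>y\<in>labels r. x < y" "\<forall>x\<in>labels l. x < snd a" "\<forall>x\<in>labels r. x < snd a"
    using Node.prems(1) by (auto simp: sorted_wrt_append)
  have lr: "sorted_wrt (<) (postorder_reading l)" "sorted_wrt (<) (postorder_reading r)"
    "heap_ordered v l" "heap_ordered v r"
    using Node.prems(1,2) by (auto simp: sorted_wrt_append)
  have "e \<noteq> snd a"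
  proof
    assume e: "e = snd a"
    then have "d \<in> labels l \<union> labels r"
      using Node.prems(3,5) by auto
    then have "v d < v (snd a)"
      using Node.prems(2) by auto
    then show False
      using Node.prems(6) e by simp
  qed
  moreover have "d \<noteq> snd a"
    using Node.prems ord by auto
  ultimately consider "d \<in> labels l" "e \<in> labels l" | "d \<in> labels r" "e \<in> labels r"
    | "d \<in> labels l" "e \<in> labels r"
    using Node.prems ord by fastforce
  then show ?case
  proof cases
    case 1
    then obtain c j s u where IH: "l = graft d (c, j) s u" "d \<in> labels u" "s \<noteq> Leaf"
      "sorted_wrt (<) (postorder_reading u)" "sorted_wrt (<) (postorder_reading s)"
      "heap_ordered v u" "heap_ordered v s"
      "\<forall>y\<in>labels u. y \<le> d \<or> j < y" "\<forall>y\<in>labels s. d < y \<and> y < j" "d < j" "v d < v j"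
      using Node.IH(1) Node.prems lr by auto
    have sub: "labels u \<subseteq> labels l" and "j \<in> labels l"
      using IH(1,2) by (auto simp: labels_graft)
    have "d \<notin> labels r"
      using 1 ord by blast
    then have "Node l a r = graft d (c, j) s (Node u a r)"
      using \<open>d \<noteq> snd a\<close> IH(1) by (simp add: graft_absent)
    moreover have "sorted_wrt (<) (postorder_reading (Node u a r))"
      using IH(4) ord lr(2) sub by (auto simp: sorted_wrt_append)
    moreover have "heap_ordered v (Node u a r)"
      using IH(6) lr(4) sub Node.prems(2) by auto
    moreover have "\<forall>y\<in>labels (Node u a r). y \<le> d \<or> j < y"
      using IH(8) ord \<open>j \<in> labels l\<close> by auto
    ultimately show ?thesis
      using IH(2,3,5,7,9-11)
      by (intro exI[of _ c] exI[of _ j] exI[of _ s] exI[of _ "Node u a r"]) simp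
  next
    case 2
    then obtain c j s u where IH: "r = graft d (c, j) s u" "d \<in> labels u" "s \<noteq> Leaf"
      "sorted_wrt (<) (postorder_reading u)" "sorted_wrt (<) (postorder_reading s)"
      "heap_ordered v u" "heap_ordered v s"
      "\<forall>y\<in>labels u. y \<le> d \<or> j < y" "\<forall>y\<in>labels s. d < y \<and> y < j" "d < j" "v d < v j"
      using Node.IH(2) Node.prems lr by auto
    have sub: "labels u \<subseteq> labels r"
      using IH(1,2) by (auto simp: labels_graft)
    have "d \<notin> labels l"
      using 2 ord by blast
    then have "Node l a r = graft d (c, j) s (Node l a u)"
      using \<open>d \<noteq> snd a\<close> IH(1) by (simp add: graft_absent)
    moreover have "sorted_wrt (<) (postorder_reading (Node l a u))"
      using IH(4) ord lr(1) sub by (auto simp: sorted_wrt_append)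
    moreover have "heap_ordered v (Node l a u)"
      using IH(6) lr(3) sub Node.prems(2) by auto
    moreover have "\<forall>y\<in>labels (Node l a u). y \<le> d \<or> j < y"
    proof -
      have "j \<in> labels r"
        using IH(1,2) by (simp add: labels_graft)
      moreover have "\<forall>x\<in>labels l. x < d"
        using ord 2(1) by blast
      ultimately show ?thesis
        using IH(8) ord by fastforce
    qed
    ultimately show ?thesis
      using IH(2,3,5,7,9-11)
      by (intro exI[of _ c] exI[of _ j] exI[of _ s] exI[of _ "Node l a u"]) simp
  next
    case 3
    then obtain l1 b l2 where l: "l = Node l1 b l2"
      by (cases l) auto
    \<comment> \<open>otherwise the root of \<open>l\<close> would be read between \<open>d\<close> and \<open>e\<close>\<close>
    have "d = snd b"
    proof (rule ccontr)
      assume "d \<noteq> snd b"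
      then have "d < snd b"
        using 3 l lr(1) by (auto simp: sorted_wrt_append)
      moreover have "snd b < e"
        using 3 l ord by auto
      ultimately show False
        using Node.prems l by auto
    qed
    then have "Node l a r = graft d (fst a, snd a) r l"
      using l by simp
    moreover have "\<forall>y\<in>labels l. y \<le> d \<or> snd a < y"
      using l lr(1) \<open>d = snd b\<close> by (auto simp: sorted_wrt_append)
    moreover have "\<forall>y\<in>labels r. d < y \<and> y < snd a"
      using 3 ord by auto
    moreover have "r \<noteq> Leaf" "d < snd a" "v d < v (snd a)"
      using 3 ord Node.prems(2) by auto
    ultimately show ?thesis
      using 3 lr by blast
  qed
qed simp

section \<open>Postorder labellings of a given shape\<close>

lemma labelling_unique:
  "skel t = skel u \<Longrightarrow> postorder_reading t = postorder_reading u \<Longrightarrow> t = u"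
proof (induction t arbitrary: u)
  case Leaf
  then show ?case by (cases u) (auto simp: skel_def)
next
  case (Node l a r)
  then obtain l' a' r' where u: "u = Node l' a' r'"
    by (cases u) (auto simp: skel_def)
  have sz: "length (postorder_reading t) = size (skel t)" for t :: "('a \<times> nat) tree"
    by (simp add: skel_def postorder_reading_def)
  have sk: "skel l = skel l'" "skel r = skel r'" "fst a = fst a'"
    using Node.prems(1) u by (auto simp: skel_def)
  then have "length (postorder_reading l) = length (postorder_reading l')"
    "length (postorder_reading r) = length (postorder_reading r')"
    by (simp_all add: sz)
  then have "postorder_reading l = postorder_reading l'" "postorder_reading r = postorder_reading r'"
    "snd a = snd a'"
    using Node.prems(2) u by auto
  then show ?case
    using Node.IH sk u by (auto simp: prod_eq_iff)
qed

lemma labelling_exists: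
  "length xs = size s \<Longrightarrow> \<exists>t. skel t = s \<and> postorder_reading t = xs"
proof (induction s arbitrary: xs)
  case Leaf
  then show ?case by (intro exI[of _ Leaf]) (auto simp: skel_def)
next
  case (Node l c r)
  obtain ys z where xs: "xs = ys @ [z]"
    using Node.prems by (cases xs rule: rev_cases) auto
  obtain t where t: "skel t = l" "postorder_reading t = take (size l) ys"
    using Node.IH(1)[of "take (size l) ys"] Node.prems xs by auto
  obtain u where u: "skel u = r" "postorder_reading u = drop (size l) ys"
    using Node.IH(2)[of "drop (size l) ys"] Node.prems xs by auto
  show ?case
    using t u xs by (intro exI[of _ "Node t (c, z) u"]) (auto simp: skel_def)
qed

section \<open>A descent whose hooks must end in the increasing tail\<close>

definition descent_set :: "(nat \<Rightarrow> nat) \<Rightarrow> nat set \<Rightarrow> nat set" where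
  "descent_set v P = {d\<in>P. \<exists>e\<in>P. d < e \<and> v e < v d \<and> (\<forall>x\<in>P. \<not> (d < x \<and> x < e))}"

lemma descent_setI:
  assumes "d \<in> P" "e \<in> P" "d < e" "v e < v d" "\<And>x. x \<in> P \<Longrightarrow> \<not> (d < x \<and> x < e)"
  shows "d \<in> descent_set v P"
  using assms unfolding descent_set_def by blast

lemma descent_setE:
  assumes "d \<in> descent_set v P"
  obtains e where "d \<in> P" "e \<in> P" "d < e" "v e < v d" "\<forall>x\<in>P. \<not> (d < x \<and> x < e)"
  using assms unfolding descent_set_def by blast

lemma exists_argmax:
  fixes v :: "'a \<Rightarrow> 'b::linorder"
  assumes "finite A" and "A \<noteq> {}"
  shows "\<exists>x\<in>A. \<forall>y\<in>A. v y \<le> v x"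
proof -
  have "Max (v ` A) \<in> v ` A"
    using assms by simp
  then obtain x where x: "x \<in> A" "v x = Max (v ` A)"
    by auto
  then have "\<forall>y\<in>A. v y \<le> v x"
    using assms(1) by simp
  then show ?thesis
    using x(1) by blast
qed

text \<open>The largest entry between the two positions cannot be at the right end, so the entry after it is
smaller.\<close>

lemma inversion_gives_descent:
  assumes "finite P" and "inj_on v P" and "x \<in> P" and "y \<in> P" and "x < y" and "v y < v x"
  shows "\<exists>e\<in>descent_set v P. x \<le> e \<and> e < y \<and> v x \<le> v e"
proof -
  define Q where "Q = {z\<in>P. x \<le> z \<and> z \<le> y}"
  have Q: "finite Q" "x \<in> Q" "y \<in> Q" "Q \<subseteq> P"
    using assms by (auto simp: Q_def)
  obtain e where e: "e \<in> Q" "\<forall>z\<in>Q. v z \<le> v e"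
    using exists_argmax[of Q] Q by blast
  have "e \<noteq> y"
    using e Q assms(6) by auto
  then have "e < y" using e(1) by (auto simp: Q_def)
  define e' where "e' = Min {z\<in>P. e < z}"
  have fe: "finite {z\<in>P. e < z}" "y \<in> {z\<in>P. e < z}"
    using assms \<open>e < y\<close> by auto
  have "e' \<in> {z\<in>P. e < z}"
    unfolding e'_def using fe by (intro Min_in) auto
  moreover have "e' \<le> y"
    unfolding e'_def using fe by (intro Min_le) auto
  ultimately have e': "e' \<in> P" "e < e'" "e' \<le> y"
    by auto
  have "\<forall>z\<in>P. \<not> (e < z \<and> z < e')"
    using Min_le[OF fe(1)] by (force simp: e'_def)
  moreover have "v e' < v e"
  proof -
    have "e' \<in> Q" using e' e(1) by (auto simp: Q_def)
    then have "v e' \<le> v e" using e by blast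
    moreover have "v e' \<noteq> v e"
      using assms(2) e' e(1) Q(4) by (metis inj_onD less_irrefl subsetD)
    ultimately show ?thesis by simp
  qed
  ultimately have "e \<in> descent_set v P"
    using e' e(1) by (intro descent_setI[of e P e']) (auto simp: Q_def)
  then show ?thesis
    using e Q \<open>e < y\<close> by (auto simp: Q_def)
qed

text \<open>Removing the hook from \<open>d\<close> to \<open>j\<close> leaves two sub-permutations: \<open>inner\<close> is strictly under the hook,
\<open>outer\<close> is the rest, without the northeast endpoint \<open>j\<close>.\<close>

definition outer :: "nat \<Rightarrow> nat \<Rightarrow> nat set \<Rightarrow> nat set" where
  "outer d j P = {x\<in>P. x \<le> d \<or> j < x}"

definition inner :: "nat \<Rightarrow> nat \<Rightarrow> nat set \<Rightarrow> nat set" where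
  "inner d j P = {x\<in>P. d < x \<and> x < j}"

text \<open>Every entry larger than that of \<open>d\<close> has only smaller entries before it and only larger ones after it.
Those entries therefore form an increasing run at the right end of the permutation that dominates
everything else, and a hook leaving \<open>d\<close> has to end in this run.\<close>

locale tail_bound_descent =
  fixes v :: "nat \<Rightarrow> nat" and P :: "nat set" and d :: nat
  assumes finite_P: "finite P"
    and inj_v: "inj_on v P"
    and descent: "d \<in> descent_set v P"
    and inversion_le: "\<And>x y. x \<in> P \<Longrightarrow> y \<in> P \<Longrightarrow> x < y \<Longrightarrow> v y < v x \<Longrightarrow> v x \<le> v d"
begin

text \<open>The possible northeast endpoints of a hook at \<open>d\<close>, and likewise the possible labels of the parent of
\<open>d\<close> in a tree.\<close>

definition targets :: "nat set" where
  "targets = {j\<in>P. v d < v j}"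

lemma d_in_P: "d \<in> P"
  using descent by (simp add: descent_set_def)

lemma descent_witness:
  obtains e where "e \<in> P" "d < e" "v e < v d" "\<forall>x\<in>P. \<not> (d < x \<and> x < e)"
  using descent unfolding descent_set_def by blast

lemma target_above_earlier:
  assumes "j \<in> targets" "x \<in> P" "x < j"
  shows "v x < v j"
proof -
  have "v x \<noteq> v j"
    using assms inj_v by (auto simp: targets_def inj_on_def)
  then show ?thesis
    using inversion_le[of x j] assms by (force simp: targets_def)
qed

lemma target_below_later:
  assumes "j \<in> targets" "x \<in> P" "j < x"
  shows "v j < v x"
proof -
  have "v x \<noteq> v j"
    using assms inj_v by (auto simp: targets_def inj_on_def)
  then show ?thesis
    using inversion_le[of j x] assms by (force simp: targets_def)
qed

lemma target_after: "j \<in> targets \<Longrightarrow> d < j"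
  using target_below_later[of j d] d_in_P
  by (metis (mono_tags, lifting) linorder_neqE_nat mem_Collect_eq order_less_asym targets_def)

lemma value_less_iff:
  assumes "j \<in> targets" "x \<in> P"
  shows "v x < v j \<longleftrightarrow> x < j"
  using assms target_above_earlier target_below_later
  by (metis less_asym' linorder_neqE_nat)

lemma inner_nonempty:
  assumes j: "j \<in> targets"
  shows "inner d j P \<noteq> {}"
proof -
  obtain e where e: "e \<in> P" "d < e" "v e < v d" using descent_witness by blast
  then have "e < j"
    using value_less_iff[OF j e(1)] j by (auto simp: targets_def)
  then show ?thesis using e by (auto simp: inner_def)
qed

lemma descent_before_target:
  assumes "j \<in> targets" "e \<in> descent_set v P"
  shows "e < j"
proof -
  have "v e \<le> v d" "e \<in> P"
    using assms(2) inversion_le by (auto elim: descent_setE)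
  then show ?thesis
    using assms(1) value_less_iff[OF assms(1), of e] by (simp add: targets_def)
qed

text \<open>Skipping from \<open>d\<close> to the entry after \<open>j\<close> creates no descent, since that entry is larger than all
others seen so far.  Hence \<open>d\<close> is the only descent of the whole that neither part inherits.\<close>

lemma descent_set_outer:
  assumes j: "j \<in> targets"
  shows "descent_set v (outer d j P) = {e\<in>descent_set v P. e < d}"
proof (intro equalityI subsetI)
  fix e assume "e \<in> descent_set v (outer d j P)"
  then obtain e' where e: "e \<in> P" "e \<le> d \<or> j < e" "e' \<in> P" "e' \<le> d \<or> j < e'" "e < e'" "v e' < v e"
    "\<forall>x\<in>P. x \<le> d \<or> j < x \<longrightarrow> \<not> (e < x \<and> x < e')"
    by (auto simp: descent_set_def outer_def)
  have "e' < j"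
  proof (rule ccontr)
    assume "\<not> e' < j"
    then have "e' \<in> targets"
      using e(3) j target_below_later[OF j e(3)] by (cases "e' = j") (auto simp: targets_def)
    then show False
      using target_above_earlier e(1,5,6) by fastforce
  qed
  then have "e' \<le> d" using e(4) by simp
  then show "e \<in> {e\<in>descent_set v P. e < d}"
    using e target_after[OF j] by (auto intro!: descent_setI[of e P e'])
next
  fix e assume "e \<in> {e\<in>descent_set v P. e < d}"
  then obtain e' where e: "e \<in> P" "e < d" "e' \<in> P" "e < e'" "v e' < v e"
    "\<forall>x\<in>P. \<not> (e < x \<and> x < e')"
    by (auto elim: descent_setE)
  then have "e' \<le> d"
    using d_in_P by force
  then show "e \<in> descent_set v (outer d j P)"
    using e by (intro descent_setI[of e _ e']) (auto simp: outer_def)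
qed

lemma descent_set_inner:
  assumes j: "j \<in> targets"
  shows "descent_set v (inner d j P) = {e\<in>descent_set v P. d < e}"
proof (intro equalityI subsetI)
  fix e assume "e \<in> descent_set v (inner d j P)"
  then obtain e' where "e \<in> inner d j P" "e' \<in> inner d j P" "e < e'" "v e' < v e"
    "\<forall>x\<in>inner d j P. \<not> (e < x \<and> x < e')"
    by (rule descent_setE)
  then show "e \<in> {e\<in>descent_set v P. d < e}"
    by (auto simp: inner_def intro!: descent_setI[of e P e'])
next
  fix e assume e: "e \<in> {e\<in>descent_set v P. d < e}"
  then obtain e' where e': "e \<in> P" "d < e" "e' \<in> P" "e < e'" "v e' < v e"
    "\<forall>x\<in>P. \<not> (e < x \<and> x < e')"
    by (auto elim: descent_setE)
  have "e < j"
    using descent_before_target e j by blast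
  then have "e' < j"
    using e' j target_above_earlier[of j e] value_less_iff[of j e'] by fastforce
  then show "e \<in> descent_set v (inner d j P)"
    using e' \<open>e < j\<close> by (intro descent_setI[of e _ e']) (auto simp: inner_def)
qed

end

text \<open>The descent with the largest entry works, because each inversion has a descent at least as high
as its larger entry.\<close>

lemma tail_bound_descent_exists:
  assumes "finite P" and "inj_on v P" and "descent_set v P \<noteq> {}"
  shows "\<exists>d. tail_bound_descent v P d"
proof -
  have "finite (descent_set v P)"
    using assms(1) by (simp add: descent_set_def)
  then obtain d where d: "d \<in> descent_set v P" "\<forall>e\<in>descent_set v P. v e \<le> v d"
    using exists_argmax[OF _ assms(3)] by blast
  have "tail_bound_descent v P d"
  proof
    fix x y assume "x \<in> P" "y \<in> P" "x < y" "v y < v x"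
    then obtain e where "e \<in> descent_set v P" "v x \<le> v e"
      using inversion_gives_descent[OF assms(1,2)] by blast
    then show "v x \<le> v d"
      using d(2) le_trans by blast
  qed (use assms d in auto)
  then show ?thesis ..
qed

section \<open>The recursion satisfied by decreasing trees\<close>

definition arrangements :: "'c tree set \<Rightarrow> (nat \<Rightarrow> nat) \<Rightarrow> nat set \<Rightarrow> ('c \<times> nat) tree set" where
  "arrangements T v P =
     {t. skel t \<in> T \<and> sorted_wrt (<) (postorder_reading t) \<and> labels t = P \<and> heap_ordered v t}"

lemma sorted_wrt_less_distinct: "sorted_wrt (<) xs \<Longrightarrow> distinct (xs :: nat list)"
  by (simp add: strict_sorted_iff)

lemma skel_eq_Leaf [simp]: "skel t = Leaf \<longleftrightarrow> t = Leaf"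
  by (cases t) (auto simp: skel_def)

text \<open>Cutting at the parent \<open>j\<close> of the vertex \<open>d\<close> turns a tree over \<open>P\<close> into a tree over the outer part and one
over the inner part.  Conversely any such pair may be grafted, since the entry at \<open>j\<close> is smaller than
all later ones.\<close>

lemma (in tail_bound_descent) arrangements_bij:
  assumes T: "troupe black T"
  shows "bij_betw (\<lambda>(j, t, s). graft d (black, j) s t)
    (SIGMA j:targets. arrangements T v (outer d j P) \<times> arrangements T v (inner d j P))
    (arrangements T v P)"
  (is "bij_betw ?g ?D _")
proof (rule bij_betwI')
  fix y y'
  assume y: "y \<in> ?D"
    and y': "y' \<in> ?D"
  obtain j t s j' t' s' where eq: "y = (j, t, s)" "y' = (j', t', s')"
    by (metis prod_cases3)
  have "d \<in> labels t" "d \<in> labels t'" "j \<noteq> d" "j' \<noteq> d"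
    "distinct (postorder_reading t)" "distinct (postorder_reading t')"
    using y y' eq d_in_P by (auto simp: arrangements_def outer_def targets_def sorted_wrt_less_distinct)
  then show "(?g y = ?g y') = (y = y')"
    using graft_inject[of d "(black, j)" s t "(black, j')" s' t'] eq by auto
next
  fix y
  assume y: "y \<in> ?D"
  obtain j t s where eq: "y = (j, t, s)"
    by (metis prod_cases3)
  have j: "j \<in> targets"
    and t: "skel t \<in> T" "sorted_wrt (<) (postorder_reading t)" "labels t = outer d j P" "heap_ordered v t"
    and s: "skel s \<in> T" "sorted_wrt (<) (postorder_reading s)" "labels s = inner d j P" "heap_ordered v s"
    using y eq by (auto simp: arrangements_def)
  have d: "d \<in> labels t"
    using t d_in_P by (simp add: outer_def)
  obtain p where p: "p \<in> vertices t" "graft d (black, j) s t = insertion (black, j) p t s"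
    using graft_eq_insertion[OF d] t(2) sorted_wrt_less_distinct by blast
  have "s \<noteq> Leaf"
    using s(3) inner_nonempty[OF j] by auto
  then have "skel (graft d (black, j) s t) \<in> T"
    using troupe_insertion_iff[OF T, of p "skel t" "skel s" black] p t(1) s(1)
    by (simp add: skel_insertion)
  moreover have "sorted_wrt (<) (postorder_reading (graft d (black, j) s t))"
    using t s target_after[OF j] by (intro sorted_graft) (auto simp: outer_def inner_def)
  moreover have "heap_ordered v (graft d (black, j) s t)"
  proof (intro heap_ordered_graft)
    show "\<forall>y\<in>labels t. d < y \<longrightarrow> v j < v y"
      using t(3) target_below_later[OF j] by (auto simp: outer_def)
    show "\<forall>y\<in>labels s. v y < v j"
      using s(3) target_above_earlier[OF j] by (simp add: inner_def)
    show "v d < v j"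
      using j by (simp add: targets_def)
  qed (fact t s)+
  moreover have "labels (graft d (black, j) s t) = P"
  proof -
    have "labels (graft d (black, j) s t) = outer d j P \<union> insert j (inner d j P)"
      using d t(3) s(3) by (simp add: labels_graft)
    also have "\<dots> = P"
      using j target_after[OF j] by (auto simp: outer_def inner_def targets_def)
    finally show ?thesis .
  qed
  ultimately show "?g y \<in> arrangements T v P"
    by (simp add: eq arrangements_def)
next
  fix t assume "t \<in> arrangements T v P"
  then have t: "skel t \<in> T" "sorted_wrt (<) (postorder_reading t)" "labels t = P" "heap_ordered v t"
    by (auto simp: arrangements_def)
  obtain e where e: "e \<in> P" "d < e" "v e < v d" "\<forall>x\<in>P. \<not> (d < x \<and> x < e)"
    using descent_witness by blast
  obtain c j s u where g: "t = graft d (c, j) s u" "d \<in> labels u" "s \<noteq> Leaf"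
    "sorted_wrt (<) (postorder_reading u)" "sorted_wrt (<) (postorder_reading s)"
    "heap_ordered v u" "heap_ordered v s"
    "\<forall>y\<in>labels u. y \<le> d \<or> j < y" "\<forall>y\<in>labels s. d < y \<and> y < j" "d < j" "v d < v j"
    using descent_is_graft[OF t(2,4), of d e] t(3) e d_in_P by metis
  have P: "P = labels u \<union> insert j (labels s)"
    using g(1,2) t(3) by (simp add: labels_graft)
  have j: "j \<in> targets"
    using P g(11) unfolding targets_def by blast
  have "labels u = outer d j P" "labels s = inner d j P"
    using P g(8-10) by (auto simp: outer_def inner_def)
  moreover obtain p where p: "p \<in> vertices u" "t = insertion (c, j) p u s"
    using graft_eq_insertion[OF g(2)] g(1,4) sorted_wrt_less_distinct by blast
  then have "c = black" "skel u \<in> T" "skel s \<in> T"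
    using troupe_insertion_iff[OF T, of p "skel u" "skel s" c] g(3) t(1)
    by (auto simp: skel_insertion)
  ultimately show "\<exists>y\<in>?D.
      t = ?g y"
    using g j by (intro bexI[of _ "(j, u, s)"]) (auto simp: arrangements_def)
qed

lemma finite_arrangements:
  fixes T :: "'c::finite tree set"
  assumes "finite P"
  shows "finite (arrangements T v P)"
proof (rule finite_subset[OF _ finite_trees_bounded[of "UNIV \<times> P" "card P"]])
  show "arrangements T v P \<subseteq> {t. set_tree t \<subseteq> UNIV \<times> P \<and> size t \<le> card P}"
  proof
    fix t assume "t \<in> arrangements T v P"
    then have t: "distinct (postorder_reading t)" "labels t = P"
      by (auto simp: arrangements_def sorted_wrt_less_distinct)
    have "snd ` set_tree t = P" "size t = card P"
      using t(2) distinct_card[OF t(1)] by (auto simp: postorder_reading_def tree.set_map)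
    then show "t \<in> {t. set_tree t \<subseteq> UNIV \<times> P \<and> size t \<le> card P}"
      by force
  qed
qed (use assms in simp)

definition monomial :: "nat \<Rightarrow> (nat \<Rightarrow> 'c tree \<Rightarrow> complex) \<Rightarrow> 'c tree \<Rightarrow> gpoly" where
  "monomial r f t = (\<Prod>i=1..r. xpow i (f i t))"

lemma monomial_insertion:
  assumes "\<And>i. i \<in> {1..r} \<Longrightarrow> insertion_additive black (f i)"
    and "p \<in> vertices t" and "s \<noteq> Leaf"
  shows "monomial r f (insertion black p t s) = monomial r f t * monomial r f s"
proof -
  have "t \<noteq> Leaf"
    using assms(2) by (cases p) (auto simp: vertices_def)
  then have "f i (insertion black p t s) = f i t + f i s" if "i \<in> {1..r}" for i
    using assms that unfolding insertion_additive_def by blast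
  then show ?thesis
    by (simp add: monomial_def xpow_add flip: prod.distrib)
qed

definition tree_sum ::
  "'c tree set \<Rightarrow> nat \<Rightarrow> (nat \<Rightarrow> 'c tree \<Rightarrow> complex) \<Rightarrow> (nat \<Rightarrow> nat) \<Rightarrow> nat set \<Rightarrow> gpoly" where
  "tree_sum T r f v P = (\<Sum>t\<in>arrangements T v P. monomial r f (skel t))"

lemma (in tail_bound_descent) tree_sum_rec:
  fixes T :: "'c::finite tree set"
  assumes T: "troupe black T"
    and f: "\<And>i. i \<in> {1..r} \<Longrightarrow> insertion_additive black (f i)"
  shows "tree_sum T r f v P =
    (\<Sum>j\<in>targets. tree_sum T r f v (outer d j P) * tree_sum T r f v (inner d j P))"
proof -
  let ?A = "arrangements T v"
  have m: "monomial r f (skel (graft d (black, j) s t)) = monomial r f (skel t) * monomial r f (skel s)"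
    if j: "j \<in> targets" and t: "t \<in> ?A (outer d j P)" and s: "s \<in> ?A (inner d j P)" for j t s
  proof -
    have "d \<in> labels t" "distinct (postorder_reading t)"
      using t d_in_P by (auto simp: arrangements_def outer_def sorted_wrt_less_distinct)
    then obtain p where p: "p \<in> vertices t" "graft d (black, j) s t = insertion (black, j) p t s"
      using graft_eq_insertion by blast
    have "s \<noteq> Leaf"
      using s inner_nonempty[OF j] by (auto simp: arrangements_def)
    then show ?thesis
      using p monomial_insertion[of r black f p "skel t" "skel s"] f by (simp add: skel_insertion)
  qed
  have fin: "finite (?A Q)" if "Q \<subseteq> P" for Q
    using finite_arrangements finite_subset[OF that finite_P] by blast
  have "tree_sum T r f v P =
    (\<Sum>(j, t, s)\<in>(SIGMA j:targets. ?A (outer d j P) \<times> ?A (inner d j P)).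
       monomial r f (skel (graft d (black, j) s t)))"
    unfolding tree_sum_def
    by (subst sum.reindex_bij_betw[OF arrangements_bij[OF T], symmetric]) (simp add: case_prod_unfold)
  also have "\<dots> = (\<Sum>(j, t, s)\<in>(SIGMA j:targets. ?A (outer d j P) \<times> ?A (inner d j P)).
       monomial r f (skel t) * monomial r f (skel s))"
    by (intro sum.cong refl) (auto simp: m)
  also have "\<dots> = (\<Sum>j\<in>targets. \<Sum>(t, s)\<in>?A (outer d j P) \<times> ?A (inner d j P).
       monomial r f (skel t) * monomial r f (skel s))"
    by (subst sum.Sigma) (auto simp: fin finite_P targets_def outer_def inner_def)
  also have "\<dots> = (\<Sum>j\<in>targets. tree_sum T r f v (outer d j P) * tree_sum T r f v (inner d j P))"
    by (simp add: tree_sum_def sum_product sum.cartesian_product)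
  finally show ?thesis .
qed

lemma bij_skel_labelled:
  "bij_betw skel {t. skel t \<in> T \<and> postorder_reading t = xs} {s\<in>T. size s = length xs}"
proof (rule bij_betwI')
  fix t u assume "t \<in> {t. skel t \<in> T \<and> postorder_reading t = xs}" "u \<in> {t. skel t \<in> T \<and> postorder_reading t = xs}"
  then show "(skel t = skel u) = (t = u)"
    by (auto intro: labelling_unique)
next
  fix t assume "t \<in> {t. skel t \<in> T \<and> postorder_reading t = xs}"
  then show "skel t \<in> {s\<in>T. size s = length xs}"
    by (auto simp: skel_def postorder_reading_def)
next
  fix s assume "s \<in> {s\<in>T. size s = length xs}"
  then show "\<exists>t\<in>{t. skel t \<in> T \<and> postorder_reading t = xs}. s = skel t"
    using labelling_exists[of xs s] by auto
qed

lemma heap_ordered_if_increasing: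
  assumes "sorted_wrt (<) (postorder_reading t)" and "strict_mono_on (labels t) v"
  shows "heap_ordered v t"
  using assms
proof (induction t)
  case (Node l a r)
  have "strict_mono_on (labels l) v" "strict_mono_on (labels r) v"
    using Node.prems(2) by (auto simp: strict_mono_on_def)
  then show ?case
    using Node by (auto simp: sorted_wrt_append strict_mono_on_def)
qed simp

lemma tree_sum_no_descents:
  assumes "finite P" and "inj_on v P" and "descent_set v P = {}"
  shows "tree_sum T r f v P = GF T r f (card P)"
proof -
  have mono: "strict_mono_on P v"
  proof (rule strict_mono_onI)
    fix x y assume xy: "x \<in> P" "y \<in> P" "x < y"
    then have "v x \<noteq> v y"
      using assms(2) by (auto simp: inj_on_def)
    then show "v x < v y"
      using inversion_gives_descent[OF assms(1,2) xy] assms(3) by force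
  qed
  have "arrangements T v P = {t. skel t \<in> T \<and> postorder_reading t = sorted_list_of_set P}"
    using mono assms(1)
    by (auto simp: arrangements_def sorted_list_of_set.idem_if_sorted_distinct
        strict_sorted_iff intro!: heap_ordered_if_increasing)
  then have "bij_betw skel (arrangements T v P) {s\<in>T. size s = card P}"
    using bij_skel_labelled[of T "sorted_list_of_set P"] by simp
  then show ?thesis
    unfolding tree_sum_def GF_def monomial_def by (rule sum.reindex_bij_betw)
qed

section \<open>The recursion satisfied by hook configurations\<close>

text \<open>A valid hook configuration as a set of pairs of positions.  The geometric condition that hooks do not
cross becomes the last clause: a hook that starts strictly inside another one ends strictly lower (and
then also inside, since no point lies above a hook).  See \<open>hooks_compatible_iff\<close>.\<close>

definition hook_config :: "(nat \<Rightarrow> nat) \<Rightarrow> nat set \<Rightarrow> (nat \<times> nat) set \<Rightarrow> bool" where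
  "hook_config v P S \<longleftrightarrow> inj_on fst S \<and> fst ` S = descent_set v P \<and>
     (\<forall>(a, b)\<in>S. b \<in> P \<and> a < b \<and> (\<forall>x\<in>P. a \<le> x \<and> x < b \<longrightarrow> v x < v b)) \<and>
     (\<forall>(a, b)\<in>S. \<forall>(a', b')\<in>S. a < a' \<and> a' < b \<longrightarrow> v b' < v b)"

definition blue_points :: "nat set \<Rightarrow> (nat \<times> nat) set \<Rightarrow> nat set" where
  "blue_points P S = {i\<in>P. i \<notin> snd ` S \<and> (\<forall>(a, b)\<in>S. \<not> (a < i \<and> i < b))}"

definition hook_points :: "(nat \<Rightarrow> nat) \<Rightarrow> nat set \<Rightarrow> (nat \<times> nat) set \<Rightarrow> nat \<times> nat \<Rightarrow> nat set" where
  "hook_points v P S h = {i\<in>P. i \<notin> snd ` S \<and> fst h < i \<and> i < snd h \<and>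
     (\<forall>(a, b)\<in>S. a < i \<and> i < b \<longrightarrow> v (snd h) \<le> v b)}"

definition config_weight ::
  "(nat \<Rightarrow> 'b::comm_semiring_1) \<Rightarrow> (nat \<Rightarrow> nat) \<Rightarrow> nat set \<Rightarrow> (nat \<times> nat) set \<Rightarrow> 'b" where
  "config_weight g v P S =
     g (card (blue_points P S)) * (\<Prod>h\<in>S. g (card (hook_points v P S h)))"

definition hook_sum ::
  "(nat \<Rightarrow> 'b::comm_semiring_1) \<Rightarrow> (nat \<Rightarrow> nat) \<Rightarrow> nat set \<Rightarrow> 'b" where
  "hook_sum g v P = (\<Sum>S | hook_config v P S. config_weight g v P S)"

lemma hook_configD:
  assumes "hook_config v P S" and "(a, b) \<in> S"
  shows "a \<in> descent_set v P" "a \<in> P" "b \<in> P" "a < b" "v a < v b"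
    and "\<And>x. x \<in> P \<Longrightarrow> a \<le> x \<Longrightarrow> x < b \<Longrightarrow> v x < v b"
proof -
  have "a \<in> fst ` S"
    using assms(2) by force
  then show a: "a \<in> descent_set v P"
    using assms(1) by (simp add: hook_config_def)
  then show aP: "a \<in> P"
    by (simp add: descent_set_def)
  show b: "b \<in> P" "a < b" and below: "\<And>x. x \<in> P \<Longrightarrow> a \<le> x \<Longrightarrow> x < b \<Longrightarrow> v x < v b"
    using assms unfolding hook_config_def by blast+
  show "v a < v b"
    using below[OF aP] b by simp
qed

lemma hook_config_nested:
  assumes "hook_config v P S" and "(a, b) \<in> S" "(a', b') \<in> S" "a < a'" "a' < b"
  shows "v b' < v b"
  using assms unfolding hook_config_def by blast

lemma finite_hook_configs:
  assumes "finite P"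
  shows "finite {S. hook_config v P S}"
proof (rule finite_subset)
  show "{S. hook_config v P S} \<subseteq> Pow (P \<times> P)"
    using hook_configD(2,3) by fastforce
qed (use assms in simp)

lemma hook_sum_no_descents:
  assumes "descent_set v P = {}"
  shows "hook_sum g v P = g (card P)"
proof -
  have "{S. hook_config v P S} = {{}}"
    using assms by (auto simp: hook_config_def)
  then show ?thesis
    by (simp add: hook_sum_def config_weight_def blue_points_def)
qed

context tail_bound_descent
begin

definition glue :: "nat \<Rightarrow> (nat \<times> nat) set \<Rightarrow> (nat \<times> nat) set \<Rightarrow> (nat \<times> nat) set" where
  "glue j S1 S2 = insert (d, j) (S1 \<union> S2)"

context
  fixes j S1 S2
  assumes j: "j \<in> targets"
    and S1: "hook_config v (outer d j P) S1"
    and S2: "hook_config v (inner d j P) S2"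
begin

lemma outer_hook:
  assumes "(a, b) \<in> S1"
  shows "a < d" "a \<in> P" "b \<in> P" "b \<le> d \<or> j < b" "a < b"
  using hook_configD[OF S1 assms] descent_set_outer[OF j] by (auto simp: outer_def)

lemma inner_hook:
  assumes "(a, b) \<in> S2"
  shows "d < a" "a \<in> P" "b \<in> P" "b < j" "a < b"
  using hook_configD[OF S2 assms] by (auto simp: inner_def)

lemma glue_parts:
  "{h\<in>glue j S1 S2. fst h < d} = S1" "{h\<in>glue j S1 S2. d < fst h} = S2"
  "{h\<in>glue j S1 S2. fst h = d} = {(d, j)}"
  using outer_hook(1) inner_hook(1) by (fastforce simp: glue_def)+

text \<open>A configuration of the outer part makes no promise about inner points.  But an outer hook that passes
over some of them ends after \<open>j\<close>, hence higher than \<open>j\<close> and than everything before \<open>j\<close>.\<close>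

lemma outer_below:
  assumes "(a, b) \<in> S1" "x \<in> P" "a \<le> x" "x < b"
  shows "v x < v b"
proof (cases "x \<in> outer d j P")
  case True
  then show ?thesis
    using hook_configD(6)[OF S1 assms(1)] assms by blast
next
  case False
  then have x: "d < x" "x \<le> j"
    using assms(2) by (auto simp: outer_def)
  then have b: "j < b"
    using outer_hook[OF assms(1)] assms(4) by auto
  then have "v j < v b"
    using target_below_later[OF j] outer_hook[OF assms(1)] by blast
  moreover have "v x \<le> v j"
    using target_above_earlier[OF j assms(2)] x by (cases "x = j") auto
  ultimately show ?thesis by simp
qed

lemma hook_config_glue: "hook_config v P (glue j S1 S2)"
proof -
  note o = outer_hook and i = inner_hook
  have "d < j" by (rule target_after[OF j])
  have "inj_on fst S1" "inj_on fst S2"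
    using S1 S2 by (simp_all add: hook_config_def)
  moreover have "fst ` S1 \<subseteq> {..<d}" "fst ` S2 \<subseteq> {d<..}"
    using o(1) i(1) by auto
  then have "d \<notin> fst ` (S1 \<union> S2)" "fst ` S1 \<inter> fst ` S2 = {}"
    by fastforce+
  ultimately have "inj_on fst (glue j S1 S2)"
    unfolding glue_def by (auto simp: inj_on_Un)
  moreover have "fst ` glue j S1 S2 = descent_set v P"
  proof -
    have "fst ` S1 = {e\<in>descent_set v P. e < d}" "fst ` S2 = {e\<in>descent_set v P. d < e}"
      using S1 S2 descent_set_outer[OF j] descent_set_inner[OF j] by (simp_all add: hook_config_def)
    then show ?thesis
      using descent by (auto simp: glue_def image_Un)
  qed
  moreover have "b \<in> P \<and> a < b \<and> (\<forall>x\<in>P. a \<le> x \<and> x < b \<longrightarrow> v x < v b)"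
    if ab: "(a, b) \<in> glue j S1 S2" for a b
  proof -
    consider "a = d" "b = j" | "(a, b) \<in> S1" | "(a, b) \<in> S2"
      using ab by (auto simp: glue_def)
    then show ?thesis
    proof cases
      case 1
      then show ?thesis
        using j \<open>d < j\<close> target_above_earlier[OF j] by (auto simp: targets_def)
    next
      case 2
      then show ?thesis using o outer_below by blast
    next
      case 3
      have "v x < v b" if "x \<in> P" "a \<le> x" "x < b" for x
        using that hook_configD(6)[OF S2 3, of x] i[OF 3] by (auto simp: inner_def)
      then show ?thesis using i[OF 3] by blast
    qed
  qed
  moreover have "v b' < v b"
    if hooks: "(a, b) \<in> glue j S1 S2" "(a', b') \<in> glue j S1 S2" "a < a'" "a' < b" for a b a' b'
  proof -
    have later: "v x \<le> v j \<Longrightarrow> (a, b) \<in> S1 \<Longrightarrow> d < b \<Longrightarrow> v x < v b" for x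
      using target_below_later[OF j, of b] o[of a b] by auto
    have low: "(a', b') \<in> S2 \<Longrightarrow> v b' < v j"
      using target_above_earlier[OF j] i(3,4) by blast
    have "(a, b) \<in> S1 \<or> a = d \<and> b = j \<or> (a, b) \<in> S2" "(a', b') \<in> S1 \<or> a' = d \<and> b' = j \<or> (a', b') \<in> S2"
      using hooks(1,2) by (auto simp: glue_def)
    moreover have "\<not> ((a, b) \<in> S2 \<and> (a', b') \<in> S1)"
      using hooks(3) o(1)[of a' b'] i(1)[of a b] by auto
    ultimately consider "(a, b) \<in> S1" "(a', b') \<in> S1" | "(a, b) \<in> S1" "a' = d" "b' = j"
      | "(a, b) \<in> S1" "(a', b') \<in> S2" | "a = d" "b = j" "(a', b') \<in> S2"
      | "(a, b) \<in> S2" "(a', b') \<in> S2"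
      using hooks(3) by (elim disjE conjE) (auto dest: o(1) i(1))
    then show ?thesis
    proof cases
      case 1 then show ?thesis using hook_config_nested[OF S1] hooks(3,4) by blast
    next
      case 2 then show ?thesis using later hooks(4) by simp
    next
      case 3 then show ?thesis using later low i(1) hooks(4) by (meson less_imp_le order_less_trans)
    next
      case 4 then show ?thesis using low by simp
    next
      case 5 then show ?thesis using hook_config_nested[OF S2] hooks(3,4) by blast
    qed
  qed
  ultimately show ?thesis
    unfolding hook_config_def by blast
qed

lemma northeast_outer: "i \<in> outer d j P \<Longrightarrow> i \<in> snd ` glue j S1 S2 \<longleftrightarrow> i \<in> snd ` S1"
proof -
  assume "i \<in> outer d j P"
  then have "i \<noteq> j" "i \<notin> snd ` S2"
    using inner_hook target_after[OF j] by (fastforce simp: outer_def)+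
  then show ?thesis by (simp add: glue_def image_Un)
qed

lemma northeast_inner: "i \<in> inner d j P \<Longrightarrow> i \<in> snd ` glue j S1 S2 \<longleftrightarrow> i \<in> snd ` S2"
proof -
  assume "i \<in> inner d j P"
  then have "i \<noteq> j" "i \<notin> snd ` S1"
    using outer_hook by (fastforce simp: inner_def)+
  then show ?thesis by (simp add: glue_def image_Un)
qed

lemma j_northeast: "j \<in> snd ` glue j S1 S2"
  by (force simp: glue_def)

lemma under_outer:
  "i \<in> outer d j P \<Longrightarrow> (a, b) \<in> glue j S1 S2 \<Longrightarrow> a < i \<Longrightarrow> i < b \<Longrightarrow> (a, b) \<in> S1"
  using inner_hook[of a b] by (auto simp: glue_def outer_def)

text \<open>The colors of the points do not change: over an outer point there are only outer hooks, and an inner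
point sees an inner hook if there is one above it, otherwise the hook from \<open>d\<close> to \<open>j\<close>, because outer
hooks are higher still.  So the sky of the inner part becomes the hook from \<open>d\<close> to \<open>j\<close>, and the sky of
the outer part stays the sky.\<close>

lemma blue_points_glue: "blue_points P (glue j S1 S2) = blue_points (outer d j P) S1"
proof (intro equalityI subsetI)
  fix i assume i: "i \<in> blue_points P (glue j S1 S2)"
  then have "i \<in> P" "i \<noteq> j" "\<not> (d < i \<and> i < j)"
    using j_northeast by (auto simp: blue_points_def glue_def)
  then have o: "i \<in> outer d j P"
    by (auto simp: outer_def)
  then show "i \<in> blue_points (outer d j P) S1"
    using i northeast_outer[OF o] by (auto simp: blue_points_def glue_def)
next
  fix i assume i: "i \<in> blue_points (outer d j P) S1"
  then have o: "i \<in> outer d j P"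
    by (simp add: blue_points_def)
  then have "\<not> (a < i \<and> i < b)" if "(a, b) \<in> glue j S1 S2" for a b
    using under_outer[OF o that] i by (auto simp: blue_points_def)
  then show "i \<in> blue_points P (glue j S1 S2)"
    using i northeast_outer[OF o] o by (auto simp: blue_points_def outer_def)
qed

lemma hook_points_outer:
  assumes h: "h \<in> S1"
  shows "hook_points v P (glue j S1 S2) h = hook_points v (outer d j P) S1 h"
proof (intro equalityI subsetI)
  obtain a b where ab: "h = (a, b)" by (cases h)
  fix i assume i: "i \<in> hook_points v P (glue j S1 S2) h"
  then have ib: "i \<in> P" "i \<noteq> j" "a < i" "i < b"
    using j_northeast ab by (auto simp: hook_points_def)
  have "\<not> (d < i \<and> i < j)"
  proof
    assume di: "d < i \<and> i < j"
    then have "v b \<le> v j"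
      using i ab by (auto simp: hook_points_def glue_def)
    moreover have "j < b"
      using outer_hook[of a b] h ab ib di by auto
    ultimately show False
      using target_below_later[OF j, of b] outer_hook[of a b] h ab by auto
  qed
  then have o: "i \<in> outer d j P"
    using ib by (auto simp: outer_def)
  then show "i \<in> hook_points v (outer d j P) S1 h"
    using i northeast_outer[OF o] by (auto simp: hook_points_def glue_def)
next
  fix i assume i: "i \<in> hook_points v (outer d j P) S1 h"
  then have o: "i \<in> outer d j P"
    by (simp add: hook_points_def)
  then have "v (snd h) \<le> v b" if "(a, b) \<in> glue j S1 S2" "a < i" "i < b" for a b
    using under_outer[OF o that] i that by (auto simp: hook_points_def)
  then show "i \<in> hook_points v P (glue j S1 S2) h"
    using i northeast_outer[OF o] o by (auto simp: hook_points_def outer_def)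
qed

lemma hook_points_middle:
  "hook_points v P (glue j S1 S2) (d, j) = blue_points (inner d j P) S2"
proof (intro equalityI subsetI)
  fix i assume i: "i \<in> hook_points v P (glue j S1 S2) (d, j)"
  then have n: "i \<in> inner d j P"
    by (simp add: hook_points_def inner_def)
  have "\<not> (a < i \<and> i < b)" if "(a, b) \<in> S2" for a b
  proof
    assume "a < i \<and> i < b"
    then have "v j \<le> v b"
      using i that by (auto simp: hook_points_def glue_def)
    then show False
      using target_above_earlier[OF j, of b] inner_hook[OF that] by auto
  qed
  then show "i \<in> blue_points (inner d j P) S2"
    using n i northeast_inner[OF n] by (auto simp: hook_points_def blue_points_def)
next
  fix i assume i: "i \<in> blue_points (inner d j P) S2"
  then have n: "i \<in> inner d j P"
    by (simp add: blue_points_def)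
  have "v j \<le> v b" if ab: "(a, b) \<in> glue j S1 S2" "a < i" "i < b" for a b
  proof -
    consider "b = j" | "(a, b) \<in> S1"
      using ab i by (auto simp: glue_def blue_points_def)
    then show ?thesis
    proof cases
      case 2
      then have "j < b"
        using outer_hook(4)[OF 2] n that by (auto simp: inner_def)
      then show ?thesis
        using target_below_later[OF j] outer_hook(3)[OF 2] less_imp_le by blast
    qed simp
  qed
  then show "i \<in> hook_points v P (glue j S1 S2) (d, j)"
    using n i northeast_inner[OF n] by (auto simp: hook_points_def blue_points_def inner_def)
qed

lemma hook_points_inner:
  assumes h: "h \<in> S2"
  shows "hook_points v P (glue j S1 S2) h = hook_points v (inner d j P) S2 h"
proof (intro equalityI subsetI)
  obtain a b where ab: "h = (a, b)" by (cases h)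
  fix i assume i: "i \<in> hook_points v P (glue j S1 S2) h"
  then have n: "i \<in> inner d j P"
    using inner_hook[of a b] h ab by (auto simp: hook_points_def inner_def)
  then show "i \<in> hook_points v (inner d j P) S2 h"
    using i northeast_inner[OF n] by (auto simp: hook_points_def glue_def)
next
  obtain a b where ab: "h = (a, b)" by (cases h)
  fix i assume i: "i \<in> hook_points v (inner d j P) S2 h"
  then have n: "i \<in> inner d j P"
    by (simp add: hook_points_def)
  have hj: "v b < v j"
    using inner_hook[of a b] h ab target_above_earlier[OF j] by auto
  have "v b \<le> v b'" if hook': "(a', b') \<in> glue j S1 S2" "a' < i" "i < b'" for a' b'
  proof -
    consider "b' = j" | "(a', b') \<in> S1" | "(a', b') \<in> S2"
      using hook'(1) by (auto simp: glue_def)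
    then show ?thesis
    proof cases
      case 2
      then have "j < b'"
        using outer_hook(4)[OF 2] n that by (auto simp: inner_def)
      then have "v j < v b'"
        using target_below_later[OF j] outer_hook(3)[OF 2] by blast
      then show ?thesis using hj by simp
    next
      case 3
      then show ?thesis using i ab that by (auto simp: hook_points_def)
    qed (use hj in simp)
  qed
  then show "i \<in> hook_points v P (glue j S1 S2) h"
    using n i ab northeast_inner[OF n] by (auto simp: hook_points_def inner_def)
qed

lemma config_weight_glue:
  "config_weight g v P (glue j S1 S2) =
     config_weight g v (outer d j P) S1 * config_weight g v (inner d j P) S2"
proof -
  have "S1 \<subseteq> P \<times> P" "S2 \<subseteq> P \<times> P"
    using outer_hook inner_hook by auto
  then have fin: "finite S1" "finite S2"
    using finite_P by (meson finite_SigmaI finite_subset)+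
  have "(d, j) \<notin> S1 \<union> S2" "S1 \<inter> S2 = {}"
    using outer_hook(1) inner_hook(1) by fastforce+
  then have "(\<Prod>h\<in>glue j S1 S2. g (card (hook_points v P (glue j S1 S2) h))) =
     g (card (blue_points (inner d j P) S2)) *
     ((\<Prod>h\<in>S1. g (card (hook_points v (outer d j P) S1 h))) *
      (\<Prod>h\<in>S2. g (card (hook_points v (inner d j P) S2 h))))"
    using fin
    by (subst (1) glue_def)
      (simp add: prod.union_disjoint hook_points_outer hook_points_middle hook_points_inner)
  then show ?thesis
    by (simp add: config_weight_def blue_points_glue mult_ac)
qed

end

text \<open>The hook at \<open>d\<close> separates the others.  A hook that starts before \<open>d\<close> either ends by \<open>d\<close> or goes over
the whole hook at \<open>d\<close>; a hook that starts after \<open>d\<close> starts before \<open>j\<close>, as there are no descents in the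
tail, and stays below.\<close>

lemma hook_config_unglue:
  assumes S: "hook_config v P S"
  obtains j S1 S2 where "j \<in> targets" "hook_config v (outer d j P) S1"
    "hook_config v (inner d j P) S2" "S = glue j S1 S2"
proof -
  note D = hook_configD[OF S]
  have "d \<in> fst ` S"
    using S descent by (simp add: hook_config_def)
  then obtain j where dj: "(d, j) \<in> S"
    by auto
  have j: "j \<in> targets"
    using D[OF dj] by (simp add: targets_def)
  have "d < j" by (rule target_after[OF j])
  have inj: "inj_on fst S" and im: "fst ` S = descent_set v P"
    using S by (simp_all add: hook_config_def)
  define S1 where "S1 = {h\<in>S. fst h < d}"
  define S2 where "S2 = {h\<in>S. d < fst h}"
  have "h = (d, j)" if "h \<in> S" "fst h = d" for h
    using inj_onD[OF inj _ that(1) dj] that(2) by simp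
  moreover have "fst (d, j) = d" by simp
  ultimately have "{h\<in>S. fst h = d} = {(d, j)}"
    using dj by blast
  moreover have "S = {h\<in>S. fst h = d} \<union> (S1 \<union> S2)"
    by (auto simp: S1_def S2_def)
  ultimately have eq: "S = glue j S1 S2"
    by (simp add: glue_def)
  have b1: "b \<le> d \<or> j < b" if "(a, b) \<in> S1" for a b
  proof (cases "b \<le> d")
    case False
    then have "v j < v b"
      using hook_config_nested[OF S _ dj] that by (auto simp: S1_def)
    then have "j < b"
      using value_less_iff[OF j, of b] D(3)[of a b] that
      by (metis (mono_tags, lifting) S1_def less_asym' linorder_neqE_nat mem_Collect_eq)
    then show ?thesis ..
  qed simp
  have b2: "a < j \<and> b < j" if "(a, b) \<in> S2" for a b
  proof -
    have ab: "(a, b) \<in> S" "d < a"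
      using that by (auto simp: S2_def)
    then have "a < j"
      using descent_before_target[OF j] D(1) by blast
    then have "v b < v j"
      using hook_config_nested[OF S dj] ab by blast
    then show ?thesis
      using value_less_iff[OF j] D(3)[OF ab(1)] \<open>a < j\<close> by blast
  qed
  have "hook_config v (outer d j P) S1"
  proof -
    have "inj_on fst S1"
      using inj by (rule inj_on_subset) (auto simp: S1_def)
    moreover have "fst ` S1 = descent_set v (outer d j P)"
    proof -
      have "fst ` S1 = {e\<in>fst ` S. e < d}"
        by (auto simp: S1_def)
      then show ?thesis
        by (simp add: im descent_set_outer[OF j])
    qed
    moreover have "b \<in> outer d j P \<and> a < b \<and> (\<forall>x\<in>outer d j P. a \<le> x \<and> x < b \<longrightarrow> v x < v b)"
      if "(a, b) \<in> S1" for a b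
      using b1[OF that] D[of a b] that by (auto simp: S1_def outer_def)
    moreover have "v b' < v b" if "(a, b) \<in> S1" "(a', b') \<in> S1" "a < a'" "a' < b" for a b a' b'
      using hook_config_nested[OF S] that by (auto simp: S1_def)
    ultimately show ?thesis
      unfolding hook_config_def by blast
  qed
  moreover have "hook_config v (inner d j P) S2"
  proof -
    have "inj_on fst S2"
      using inj by (rule inj_on_subset) (auto simp: S2_def)
    moreover have "fst ` S2 = descent_set v (inner d j P)"
    proof -
      have "fst ` S2 = {e\<in>fst ` S. d < e}"
        by (auto simp: S2_def)
      then show ?thesis
        by (simp add: im descent_set_inner[OF j])
    qed
    moreover have "b \<in> inner d j P \<and> a < b \<and> (\<forall>x\<in>inner d j P. a \<le> x \<and> x < b \<longrightarrow> v x < v b)"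
      if "(a, b) \<in> S2" for a b
      using b2[OF that] D[of a b] that by (auto simp: S2_def inner_def)
    moreover have "v b' < v b" if "(a, b) \<in> S2" "(a', b') \<in> S2" "a < a'" "a' < b" for a b a' b'
      using hook_config_nested[OF S] that by (auto simp: S2_def)
    ultimately show ?thesis
      unfolding hook_config_def by blast
  qed
  ultimately show ?thesis
    using that j eq by blast
qed

lemma hook_config_bij:
  "bij_betw (\<lambda>(j, S1, S2). glue j S1 S2)
    (SIGMA j:targets. {S. hook_config v (outer d j P) S} \<times> {S. hook_config v (inner d j P) S})
    {S. hook_config v P S}"
  (is "bij_betw ?g ?D _")
proof (rule bij_betwI')
  fix y y'
  assume y: "y \<in> ?D"
    and y': "y' \<in> ?D"
  obtain j S1 S2 j' S1' S2' where eq: "y = (j, S1, S2)" "y' = (j', S1', S2')"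
    by (metis prod_cases3)
  have "j = j' \<and> S1 = S1' \<and> S2 = S2'" if "glue j S1 S2 = glue j' S1' S2'"
    using glue_parts[of j S1 S2] glue_parts[of j' S1' S2'] y y' eq that by auto
  then show "(?g y = ?g y') = (y = y')"
    using eq by auto
next
  fix y
  assume "y \<in> ?D"
  then show "?g y \<in> {S. hook_config v P S}"
    using hook_config_glue by auto
next
  fix S assume "S \<in> {S. hook_config v P S}"
  then obtain j S1 S2 where "j \<in> targets" "hook_config v (outer d j P) S1"
    "hook_config v (inner d j P) S2" "S = glue j S1 S2"
    using hook_config_unglue by blast
  then show "\<exists>y\<in>?D.
      S = ?g y"
    by (intro bexI[of _ "(j, S1, S2)"]) auto
qed

lemma hook_sum_rec:
  "hook_sum g v P = (\<Sum>j\<in>targets. hook_sum g v (outer d j P) * hook_sum g v (inner d j P))"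
proof -
  let ?C = "\<lambda>Q. {S. hook_config v Q S}"
  have fin: "finite (?C Q)" if "Q \<subseteq> P" for Q
    using finite_hook_configs finite_subset[OF that finite_P] by blast
  have "hook_sum g v P =
    (\<Sum>(j, S1, S2)\<in>(SIGMA j:targets. ?C (outer d j P) \<times> ?C (inner d j P)).
       config_weight g v P (glue j S1 S2))"
    unfolding hook_sum_def
    by (subst sum.reindex_bij_betw[OF hook_config_bij, symmetric]) (simp add: case_prod_unfold)
  also have "\<dots> = (\<Sum>(j, S1, S2)\<in>(SIGMA j:targets. ?C (outer d j P) \<times> ?C (inner d j P)).
       config_weight g v (outer d j P) S1 * config_weight g v (inner d j P) S2)"
    by (intro sum.cong refl) (auto simp: config_weight_glue)
  also have "\<dots> = (\<Sum>j\<in>targets. \<Sum>(S1, S2)\<in>?C (outer d j P) \<times> ?C (inner d j P).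
       config_weight g v (outer d j P) S1 * config_weight g v (inner d j P) S2)"
    by (subst sum.Sigma) (auto simp: fin finite_P targets_def outer_def inner_def)
  also have "\<dots> = (\<Sum>j\<in>targets. hook_sum g v (outer d j P) * hook_sum g v (inner d j P))"
    by (simp add: hook_sum_def sum_product sum.cartesian_product)
  finally show ?thesis .
qed

end

section \<open>Both sums agree\<close>

text \<open>Outer and inner part are both proper subsets, since \<open>j\<close> belongs to neither.  This is why the recursion
determines the two sums.\<close>

theorem tree_sum_eq_hook_sum:
  fixes T :: "'c::finite tree set"
  assumes "troupe black T"
    and "\<And>i. i \<in> {1..r} \<Longrightarrow> insertion_additive black (f i)"
    and "finite P" and "inj_on v P"
  shows "tree_sum T r f v P = hook_sum (GF T r f) v P"
  using assms(3,4)
proof (induction "card P" arbitrary: P rule: less_induct)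
  case less
  show ?case
  proof (cases "descent_set v P = {}")
    case True
    then show ?thesis
      using less.prems by (simp add: tree_sum_no_descents hook_sum_no_descents)
  next
    case False
    then obtain d where "tail_bound_descent v P d"
      using tail_bound_descent_exists less.prems by blast
    then interpret tail_bound_descent v P d .
    have IH: "tree_sum T r f v Q = hook_sum (GF T r f) v Q" if "Q \<subset> P" for Q
      using less.hyps[of Q] less.prems psubset_card_mono[OF less.prems(1) that] that
      by (meson finite_subset inj_on_subset psubset_imp_subset)
    have "outer d j P \<subset> P" "inner d j P \<subset> P" if "j \<in> targets" for j
    proof -
      have "j \<in> P" "j \<notin> outer d j P" "j \<notin> inner d j P"
        using that target_after[OF that] by (auto simp: outer_def inner_def targets_def)
      then show "outer d j P \<subset> P" "inner d j P \<subset> P"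
        by (auto simp: outer_def inner_def)
    qed
    then show ?thesis
      using tree_sum_rec[OF assms(1,2)] by (simp add: hook_sum_rec IH)
  qed
qed

section \<open>Decreasing trees with a given postorder reading\<close>

lemma subtree_at_Leaf [simp]: "subtree_at Leaf p = Leaf"
  by (cases p) auto

lemma vertices_Leaf [simp]: "vertices Leaf = {}"
  by (simp add: vertices_def)

lemma vertices_Node:
  "vertices (Node l a r) = insert [] ((#) Lft ` vertices l \<union> (#) Rgt ` vertices r)"
proof -
  have "p \<in> vertices (Node l a r) \<longleftrightarrow> p \<in> insert [] ((#) Lft ` vertices l \<union> (#) Rgt ` vertices r)" for p
    by (cases "(Node l a r, p)" rule: subtree_at.cases) (auto simp: vertices_def)
  then show ?thesis by blast
qed

lemma label_at_simps [simp]: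
  "label_at (Node l a r) [] = a"
  "label_at (Node l a r) (Lft # p) = label_at l p"
  "label_at (Node l a r) (Rgt # p) = label_at r p"
  by (simp_all add: label_at_def)

lemma label_at_in_labels: "p \<in> vertices t \<Longrightarrow> snd (label_at t p) \<in> labels t"
  by (induction t arbitrary: p) (auto simp: vertices_Node)

lemma inj_on_label_at:
  "distinct (postorder_reading t) \<Longrightarrow> inj_on (\<lambda>p. snd (label_at t p)) (vertices t)"
proof (induction t)
  case (Node l a r)
  let ?f = "\<lambda>p. snd (label_at (Node l a r) p)"
  have "inj_on ?f ((#) Lft ` vertices l)" "inj_on ?f ((#) Rgt ` vertices r)"
    using Node by (auto simp: inj_on_def)
  moreover have "?f ` ((#) Lft ` vertices l) \<subseteq> labels l" "?f ` ((#) Rgt ` vertices r) \<subseteq> labels r"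
    using label_at_in_labels by auto
  moreover have "labels l \<inter> labels r = {}" "?f [] \<notin> labels l \<union> labels r"
    using Node.prems by auto
  ultimately show ?case
    unfolding vertices_Node inj_on_insert inj_on_Un by blast
qed simp

text \<open>The order condition on decreasing trees, separated from the conditions on the set of labels so that it
can be unfolded one node at a time.\<close>

definition parents_larger :: "('c \<times> nat) tree \<Rightarrow> bool" where
  "parents_larger t \<longleftrightarrow>
     (\<forall>p d. p @ [d] \<in> vertices t \<longrightarrow> snd (label_at t (p @ [d])) < snd (label_at t p))"

lemma parents_larger_Node:
  "parents_larger (Node l a r) \<longleftrightarrow>
     (l \<noteq> Leaf \<longrightarrow> snd (value l) < snd a) \<and> (r \<noteq> Leaf \<longrightarrow> snd (value r) < snd a) \<and>
     parents_larger l \<and> parents_larger r"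
proof
  assume *: "parents_larger (Node l a r)"
  have L: "Lft # q @ [d] \<in> vertices (Node l a r) \<Longrightarrow> snd (label_at l (q @ [d])) < snd (label_at l q)"
    and R: "Rgt # q @ [d] \<in> vertices (Node l a r) \<Longrightarrow> snd (label_at r (q @ [d])) < snd (label_at r q)" for q d
    using * unfolding parents_larger_def by (metis append_Cons label_at_simps(2,3))+
  moreover have "[] @ [Lft] \<in> vertices (Node l a r) \<longrightarrow> snd (label_at l []) < snd a"
    "[] @ [Rgt] \<in> vertices (Node l a r) \<longrightarrow> snd (label_at r []) < snd a"
    using * unfolding parents_larger_def by (metis append_Nil label_at_simps)+
  ultimately show "(l \<noteq> Leaf \<longrightarrow> snd (value l) < snd a) \<and> (r \<noteq> Leaf \<longrightarrow> snd (value r) < snd a) \<and>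
     parents_larger l \<and> parents_larger r"
    by (auto simp: parents_larger_def vertices_def label_at_def)
next
  assume *: "(l \<noteq> Leaf \<longrightarrow> snd (value l) < snd a) \<and> (r \<noteq> Leaf \<longrightarrow> snd (value r) < snd a) \<and>
     parents_larger l \<and> parents_larger r"
  show "parents_larger (Node l a r)"
    unfolding parents_larger_def
  proof (intro allI impI)
    fix p d assume "p @ [d] \<in> vertices (Node l a r)"
    then show "snd (label_at (Node l a r) (p @ [d])) < snd (label_at (Node l a r) p)"
    proof (cases p)
      case Nil
      then show ?thesis
        using * \<open>p @ [d] \<in> _\<close> by (cases d) (auto simp: vertices_def label_at_def)
    next
      case (Cons s q)
      then show ?thesis
        using * \<open>p @ [d] \<in> _\<close> by (cases s) (auto simp: vertices_Node parents_larger_def)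
    qed
  qed
qed

lemma heap_ordered_below_root:
  "heap_ordered v t \<Longrightarrow> x \<in> labels t \<Longrightarrow> v x \<le> v (snd (value t))"
  by (cases t) (auto simp: less_imp_le)

lemma heap_ordered_iff_parents_larger: "heap_ordered (\<lambda>x. x) t \<longleftrightarrow> parents_larger t"
proof (induction t)
  case Leaf
  then show ?case by (simp add: parents_larger_def)
next
  case (Node l a r)
  have "(\<forall>x\<in>labels u. x < n) \<longleftrightarrow> (u \<noteq> Leaf \<longrightarrow> snd (value u) < n)"
    if "heap_ordered (\<lambda>x. x) u" for u :: "('a \<times> nat) tree" and n
  proof -
    have "snd (value u) \<in> labels u" if "u \<noteq> Leaf"
      using that by (cases u) auto
    moreover have "labels Leaf = {}" by simp
    ultimately show ?thesis
      using heap_ordered_below_root[OF that] le_less_trans by (metis empty_iff)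
  qed
  from this[of l "snd a"] this[of r "snd a"] show ?case
    using Node.IH by (auto simp: parents_larger_Node)
qed

lemma decreasing_iff:
  assumes "is_perm (postorder_reading t)"
  shows "decreasing t \<longleftrightarrow> heap_ordered (\<lambda>x. x) t"
proof -
  have "inj_on (\<lambda>p. snd (label_at t p)) (vertices t)"
    using assms inj_on_label_at by (auto simp: is_perm_def)
  moreover have "\<forall>p\<in>vertices t. snd (label_at t p) > 0"
    using assms label_at_in_labels by (force simp: is_perm_def)
  ultimately show ?thesis
    by (simp add: decreasing_def heap_ordered_iff_parents_larger parents_larger_def)
qed

definition relabel :: "(nat \<Rightarrow> nat) \<Rightarrow> ('c \<times> nat) tree \<Rightarrow> ('c \<times> nat) tree" where
  "relabel v = map_tree (apsnd v)"

lemma skel_relabel [simp]: "skel (relabel v t) = skel t"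
  by (induction t) (auto simp: skel_def relabel_def)

lemma postorder_relabel [simp]: "postorder_reading (relabel v t) = map v (postorder_reading t)"
  by (induction t) (auto simp: relabel_def)

lemma heap_ordered_relabel [simp]: "heap_ordered w (relabel v t) \<longleftrightarrow> heap_ordered (\<lambda>x. w (v x)) t"
proof (induction t)
  case (Node l a r)
  then show ?case
    using postorder_relabel[of v l] postorder_relabel[of v r] by (auto simp: relabel_def)
qed (simp add: relabel_def)

lemma arrangements_upto:
  "arrangements T v {..<n} = {t. skel t \<in> T \<and> postorder_reading t = [0..<n] \<and> heap_ordered v t}"
proof -
  have "sorted_wrt (<) xs \<and> set xs = {..<n} \<longleftrightarrow> xs = [0..<n]" for xs
    using sorted_list_of_set.idem_if_sorted_distinct[of xs]
    by (auto simp: strict_sorted_iff lessThan_atLeast0)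
  then show ?thesis
    by (auto simp: arrangements_def)
qed

text \<open>On both sides the shape determines the labels, since the postorder word is prescribed.\<close>

lemma relabel_bij:
  assumes "is_perm \<pi>"
  shows "bij_betw (relabel ((!) \<pi>)) (arrangements T ((!) \<pi>) {..<length \<pi>})
    {t\<in>decreasing_over T. postorder_reading t = \<pi>}"
proof -
  have fiber: "{t\<in>decreasing_over T. postorder_reading t = \<pi>} =
      {t. skel t \<in> T \<and> postorder_reading t = \<pi> \<and> heap_ordered (\<lambda>x. x) t}"
    using assms decreasing_iff by (auto simp: decreasing_over_def)
  show ?thesis
    unfolding fiber arrangements_upto
  proof (rule bij_betwI')
    fix t u
    assume "t \<in> {t. skel t \<in> T \<and> postorder_reading t = [0..<length \<pi>] \<and> heap_ordered ((!) \<pi>) t}"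
      and "u \<in> {t. skel t \<in> T \<and> postorder_reading t = [0..<length \<pi>] \<and> heap_ordered ((!) \<pi>) t}"
    then show "(relabel ((!) \<pi>) t = relabel ((!) \<pi>) u) = (t = u)"
      by (metis (mono_tags, lifting) labelling_unique mem_Collect_eq skel_relabel)
  next
    fix t assume "t \<in> {t. skel t \<in> T \<and> postorder_reading t = [0..<length \<pi>] \<and> heap_ordered ((!) \<pi>) t}"
    then show "relabel ((!) \<pi>) t \<in> {t. skel t \<in> T \<and> postorder_reading t = \<pi> \<and> heap_ordered (\<lambda>x. x) t}"
      by (simp add: map_nth)
  next
    fix u assume "u \<in> {t. skel t \<in> T \<and> postorder_reading t = \<pi> \<and> heap_ordered (\<lambda>x. x) t}"
    then have u: "skel u \<in> T" "postorder_reading u = \<pi>" "heap_ordered (\<lambda>x. x) u"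
      by auto
    have "size (skel u) = length \<pi>"
      using u(2) by (auto simp: skel_def postorder_reading_def)
    then obtain t where t: "skel t = skel u" "postorder_reading t = [0..<length \<pi>]"
      using labelling_exists[of "[0..<length \<pi>]" "skel u"] by auto
    then have "relabel ((!) \<pi>) t = u"
      using u(2) by (intro labelling_unique) (simp_all add: map_nth)
    moreover from this have "heap_ordered ((!) \<pi>) t"
      using u(3) heap_ordered_relabel[of "\<lambda>x. x" "(!) \<pi>" t] by simp
    ultimately show "\<exists>t\<in>{t. skel t \<in> T \<and> postorder_reading t = [0..<length \<pi>] \<and> heap_ordered ((!) \<pi>) t}.
        u = relabel ((!) \<pi>) t"
      using t u by auto
  qed
qed

lemma postorder_fiber_sum:
  assumes "is_perm \<pi>"
  shows "(\<Sum>t\<in>{t\<in>decreasing_over T. postorder_reading t = \<pi>}. \<Prod>i=1..r. xpow i (ddot (f i) t)) =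
    tree_sum T r f ((!) \<pi>) {..<length \<pi>}"
  unfolding tree_sum_def
  by (subst sum.reindex_bij_betw[OF relabel_bij[OF assms], symmetric])
    (simp add: ddot_def monomial_def)

section \<open>Hook configurations as sets of hooks\<close>

lemma set_descents: "set (descents \<pi>) = descent_set ((!) \<pi>) {..<length \<pi>}"
proof (intro equalityI subsetI)
  fix i assume "i \<in> set (descents \<pi>)"
  then show "i \<in> descent_set ((!) \<pi>) {..<length \<pi>}"
    by (intro descent_setI[of i _ "Suc i"]) (auto simp: descents_def)
next
  fix i assume "i \<in> descent_set ((!) \<pi>) {..<length \<pi>}"
  then obtain e where e: "e < length \<pi>" "i < e" "\<pi> ! e < \<pi> ! i" "\<forall>x\<in>{..<length \<pi>}. \<not> (i < x \<and> x < e)"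
    by (auto elim: descent_setE)
  then have "e = Suc i"
    by (metis Suc_lessI lessI lessThan_iff order_less_trans)
  then show "i \<in> set (descents \<pi>)"
    using e by (auto simp: descents_def)
qed

lemma distinct_descents: "distinct (descents \<pi>)"
  by (simp add: descents_def)

text \<open>The later hook lies to the right of the vertical part of the earlier one.  So the curves can only meet
on the horizontal part of the earlier hook, and if they do, they meet where that part crosses the
vertical part of the later hook.\<close>

lemma hook_curves_meet_iff:
  assumes "is_hook \<pi> h" "is_hook \<pi> h'" "distinct \<pi>" "fst h < fst h'"
  shows "hook_curve \<pi> h \<inter> hook_curve \<pi> h' \<noteq> {} \<longleftrightarrow>
    fst h' \<le> snd h \<and> \<pi> ! fst h' \<le> \<pi> ! snd h \<and> \<pi> ! snd h \<le> \<pi> ! snd h'"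
proof
  assume "hook_curve \<pi> h \<inter> hook_curve \<pi> h' \<noteq> {}"
  then obtain x y where xy: "(x, y) \<in> hook_curve \<pi> h" "(x, y) \<in> hook_curve \<pi> h'"
    by auto
  have h: "x = real (fst h) \<or> x \<le> real (snd h) \<and> y = real (\<pi> ! snd h)"
    using xy(1) by (auto simp: hook_curve_def)
  have h': "x = real (fst h') \<and> real (\<pi> ! fst h') \<le> y \<and> y \<le> real (\<pi> ! snd h') \<or>
      real (fst h') \<le> x \<and> y = real (\<pi> ! snd h')"
    using xy(2) by (auto simp: hook_curve_def)
  have "x \<noteq> real (fst h)"
    using h' assms(4) by auto
  then have x: "x \<le> real (snd h)" "y = real (\<pi> ! snd h)"
    using h by auto
  from h' show "fst h' \<le> snd h \<and> \<pi> ! fst h' \<le> \<pi> ! snd h \<and> \<pi> ! snd h \<le> \<pi> ! snd h'"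
  proof
    assume *: "real (fst h') \<le> x \<and> y = real (\<pi> ! snd h')"
    then have "\<pi> ! snd h = \<pi> ! snd h'"
      using x by simp
    then have "snd h = snd h'"
      using assms by (simp add: is_hook_def nth_eq_iff_index_eq)
    then show ?thesis
      using assms(2) by (simp add: is_hook_def)
  qed (use x in auto)
next
  assume *: "fst h' \<le> snd h \<and> \<pi> ! fst h' \<le> \<pi> ! snd h \<and> \<pi> ! snd h \<le> \<pi> ! snd h'"
  then have "(real (fst h'), real (\<pi> ! snd h)) \<in> hook_curve \<pi> h \<inter> hook_curve \<pi> h'"
    using assms(4) by (auto simp: hook_curve_def)
  then show "hook_curve \<pi> h \<inter> hook_curve \<pi> h' \<noteq> {}"
    by blast
qed

lemma hooks_compatible_iff:
  assumes "is_hook \<pi> h" "is_hook \<pi> h'" "distinct \<pi>" "fst h < fst h'"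
    and "\<forall>x. fst h < x \<and> x < snd h \<longrightarrow> \<pi> ! x < \<pi> ! snd h"
  shows "hook_curve \<pi> h \<inter> hook_curve \<pi> h' = {} \<or> snd h = fst h' \<or> snd h' = fst h \<longleftrightarrow>
    (fst h' < snd h \<longrightarrow> \<pi> ! snd h' < \<pi> ! snd h)"
proof -
  have "snd h' \<noteq> fst h"
    using assms(2,4) by (auto simp: is_hook_def)
  moreover have "\<pi> ! fst h' < \<pi> ! snd h" if "fst h' < snd h"
    using assms(4,5) that by blast
  ultimately show ?thesis
    using hook_curves_meet_iff[OF assms(1-4)] by (metis less_imp_le linorder_not_less order_le_less)
qed

lemma VHC_iff:
  assumes "distinct \<pi>"
  shows "H \<in> VHC \<pi> \<longleftrightarrow>
    map fst H = descents \<pi> \<and> hook_config ((!) \<pi>) {..<length \<pi>} (set H)"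
proof (cases "map fst H = descents \<pi> \<and> (\<forall>h\<in>set H. is_hook \<pi> h) \<and>
    (\<forall>h\<in>set H. \<forall>x. fst h < x \<and> x < snd h \<longrightarrow> \<pi> ! x < \<pi> ! snd h)")
  case True
  then have fst: "map fst H = descents \<pi>" and hook: "\<forall>h\<in>set H. is_hook \<pi> h"
    and above: "\<forall>h\<in>set H. \<forall>x. fst h < x \<and> x < snd h \<longrightarrow> \<pi> ! x < \<pi> ! snd h"
    by blast+
  have dist: "distinct (map fst H)"
    by (simp add: fst distinct_descents)
  then have inj: "inj_on fst (set H)" "distinct H"
    by (simp_all add: distinct_map)
  let ?ok = "\<lambda>h h'. hook_curve \<pi> h \<inter> hook_curve \<pi> h' = {} \<or> snd h = fst h' \<or> snd h' = fst h"
  have "(\<forall>m<length H. \<forall>m'<length H. m \<noteq> m' \<longrightarrow> ?ok (H ! m) (H ! m')) \<longleftrightarrow>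
      (\<forall>h\<in>set H. \<forall>h'\<in>set H. h \<noteq> h' \<longrightarrow> ?ok h h')"
    using inj(2) by (smt (verit, best) in_set_conv_nth nth_eq_iff_index_eq nth_mem)
  also have "\<dots> \<longleftrightarrow> (\<forall>h\<in>set H. \<forall>h'\<in>set H. fst h < fst h' \<longrightarrow> ?ok h h')"
  proof (intro iffI ballI impI)
    fix h h' assume *: "\<forall>h\<in>set H. \<forall>h'\<in>set H. fst h < fst h' \<longrightarrow> ?ok h h'"
      and hh: "h \<in> set H" "h' \<in> set H" "h \<noteq> h'"
    then have "fst h < fst h' \<or> fst h' < fst h"
      using inj(1) by (metis inj_onD linorder_neqE_nat)
    then show "?ok h h'"
    proof
      assume "fst h < fst h'"
      with * hh show ?thesis by blast
    next
      assume "fst h' < fst h"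
      with * hh have "?ok h' h" by blast
      then show ?thesis by (simp add: Int_commute disj_commute)
    qed
  next
    fix h h' assume *: "\<forall>h\<in>set H. \<forall>h'\<in>set H. h \<noteq> h' \<longrightarrow> ?ok h h'"
      and hh: "h \<in> set H" "h' \<in> set H" "fst h < fst h'"
    then have "h \<noteq> h'" by auto
    with * hh(1,2) show "?ok h h'" by blast
  qed
  also have "\<dots> \<longleftrightarrow> (\<forall>h\<in>set H. \<forall>h'\<in>set H. fst h < fst h' \<longrightarrow>
      fst h' < snd h \<longrightarrow> \<pi> ! snd h' < \<pi> ! snd h)"
    using hooks_compatible_iff[OF _ _ assms] hook above by blast
  finally have "H \<in> VHC \<pi> \<longleftrightarrow> (\<forall>h\<in>set H. \<forall>h'\<in>set H. fst h < fst h' \<longrightarrow>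
      fst h' < snd h \<longrightarrow> \<pi> ! snd h' < \<pi> ! snd h)"
    using fst hook above unfolding VHC_def by blast
  moreover have "fst ` set H = descent_set ((!) \<pi>) {..<length \<pi>}"
    using fst set_descents by (metis set_map)
  moreover have "\<forall>h\<in>set H. snd h \<in> {..<length \<pi>} \<and> fst h < snd h \<and>
      (\<forall>x\<in>{..<length \<pi>}. fst h \<le> x \<and> x < snd h \<longrightarrow> \<pi> ! x < \<pi> ! snd h)"
  proof
    fix h assume h: "h \<in> set H"
    have "\<pi> ! x < \<pi> ! snd h" if "fst h \<le> x" "x < snd h" for x
      using hook above h that by (cases "x = fst h") (simp_all add: is_hook_def)
    then show "snd h \<in> {..<length \<pi>} \<and> fst h < snd h \<and>
        (\<forall>x\<in>{..<length \<pi>}. fst h \<le> x \<and> x < snd h \<longrightarrow> \<pi> ! x < \<pi> ! snd h)"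
      using hook h by (simp add: is_hook_def)
  qed
  ultimately show ?thesis
    unfolding hook_config_def case_prod_unfold using fst inj(1) by (simp add: imp_conjL)
next
  case False
  \<comment> \<open>the conditions on single hooks are part of both descriptions\<close>
  have "\<not> (map fst H = descents \<pi> \<and> hook_config ((!) \<pi>) {..<length \<pi>} (set H))"
  proof
    assume *: "map fst H = descents \<pi> \<and> hook_config ((!) \<pi>) {..<length \<pi>} (set H)"
    have "is_hook \<pi> h \<and> (\<forall>x. fst h < x \<and> x < snd h \<longrightarrow> \<pi> ! x < \<pi> ! snd h)" if "h \<in> set H" for h
      using hook_configD[OF conjunct2[OF *], of "fst h" "snd h"] that by (auto simp: is_hook_def)
    then show False using * False by blast
  qed
  moreover have "H \<notin> VHC \<pi>"
    using False unfolding VHC_def by blast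
  ultimately show ?thesis by blast
qed

text \<open>No information is lost in forgetting the order of the hooks, as it is the order of their southwest
endpoints.\<close>

lemma VHC_bij:
  assumes "distinct \<pi>"
  shows "bij_betw set (VHC \<pi>) {S. hook_config ((!) \<pi>) {..<length \<pi>} S}"
proof (rule bij_betwI')
  fix H H' assume "H \<in> VHC \<pi>" "H' \<in> VHC \<pi>"
  then have eq: "map fst H = map fst H'" and dist: "distinct (map fst H)" "distinct (map fst H')"
    using VHC_iff[OF assms] distinct_descents by metis+
  \<comment> \<open>a list of hooks is determined by its southwest endpoints and the finite map it represents\<close>
  have recover: "K = map (\<lambda>a. (a, the (map_of K a))) (map fst K)"
    if "distinct (map fst K)" for K :: "(nat \<times> nat) list"
  proof (rule nth_equalityI)
    fix n assume "n < length K"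
    then have "map_of K (fst (K ! n)) = Some (snd (K ! n))"
      using that by (intro map_of_is_SomeI) simp_all
    then show "K ! n = map (\<lambda>a. (a, the (map_of K a))) (map fst K) ! n"
      using \<open>n < length K\<close> by simp
  qed simp
  have "H = H'" if "set H = set H'"
    using recover[OF dist(1)] recover[OF dist(2)] eq map_of_inject_set[OF dist] that by metis
  then show "(set H = set H') = (H = H')" by blast
next
  fix H assume "H \<in> VHC \<pi>"
  then show "set H \<in> {S. hook_config ((!) \<pi>) {..<length \<pi>} S}"
    using VHC_iff[OF assms] by blast
next
  fix S assume "S \<in> {S. hook_config ((!) \<pi>) {..<length \<pi>} S}"
  then have S: "hook_config ((!) \<pi>) {..<length \<pi>} S" by simp
  then have inj: "inj_on fst S" and im: "fst ` S = set (descents \<pi>)"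
    by (simp_all add: hook_config_def set_descents)
  define H where "H = map (inv_into S fst) (descents \<pi>)"
  have "map fst H = descents \<pi>"
    using im by (auto simp: H_def f_inv_into_f intro!: map_idI)
  moreover have "set H = S"
    using inj by (simp add: H_def im[symmetric] inv_into_image_cancel)
  ultimately show "\<exists>H\<in>VHC \<pi>. S = set H"
    using S VHC_iff[OF assms] by auto
qed

lemma GF_seq_color_counts:
  assumes "H \<in> VHC \<pi>"
  shows "GF_seq T r f (color_counts \<pi> H) =
    config_weight (GF T r f) ((!) \<pi>) {..<length \<pi>} (set H)"
proof -
  let ?g = "GF T r f"
  have "distinct (map fst H)"
    using assms distinct_descents unfolding VHC_def by (metis (mono_tags, lifting) mem_Collect_eq)
  then have "distinct H"
    by (simp add: distinct_map)
  then have nth: "bij_betw ((!) H) {..<length H} (set H)"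
    by (simp add: bij_betw_nth)
  have under: "(\<exists>m. under H i m \<and> Q (H ! m)) \<longleftrightarrow> (\<exists>h\<in>set H. fst h < i \<and> i < snd h \<and> Q h)" for i Q
  proof -
    have "(\<exists>h\<in>set H. fst h < i \<and> i < snd h \<and> Q h) \<longleftrightarrow>
        (\<exists>m<length H. fst (H ! m) < i \<and> i < snd (H ! m) \<and> Q (H ! m))"
      unfolding in_set_conv_nth Bex_def by metis
    then show ?thesis
      by (simp add: under_def conj_assoc)
  qed
  have "{i. i < length \<pi> \<and> i \<notin> northeast H \<and> (\<forall>m. \<not> under H i m)} =
      blue_points {..<length \<pi>} (set H)"
  proof -
    have "(\<forall>m. \<not> under H i m) \<longleftrightarrow> (\<forall>(a, b)\<in>set H. \<not> (a < i \<and> i < b))" for i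
      using under[of i "\<lambda>_. True"] unfolding case_prod_unfold by blast
    then show ?thesis
      by (auto simp: blue_points_def northeast_def)
  qed
  moreover have "{i. i < length \<pi> \<and> i \<notin> northeast H \<and> sees \<pi> H i m} =
      hook_points ((!) \<pi>) {..<length \<pi>} (set H) (H ! m)" if m: "m < length H" for m
  proof -
    have "sees \<pi> H i m \<longleftrightarrow> fst (H ! m) < i \<and> i < snd (H ! m) \<and>
        (\<forall>(a, b)\<in>set H. a < i \<and> i < b \<longrightarrow> \<pi> ! snd (H ! m) \<le> \<pi> ! b)" for i
      using under[of i "\<lambda>h. \<not> \<pi> ! snd (H ! m) \<le> \<pi> ! snd h"] m
      unfolding sees_def under_def[of H i m] case_prod_unfold by blast
    then show ?thesis
      by (auto simp: hook_points_def northeast_def)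
  qed
  ultimately have "GF_seq T r f (color_counts \<pi> H) =
      ?g (card (blue_points {..<length \<pi>} (set H))) *
      (\<Prod>m<length H. ?g (card (hook_points ((!) \<pi>) {..<length \<pi>} (set H) (H ! m))))"
    by (simp add: GF_seq_def color_counts_def prod.lessThan_Suc_shift del: prod.lessThan_Suc)
  also have "(\<Prod>m<length H. ?g (card (hook_points ((!) \<pi>) {..<length \<pi>} (set H) (H ! m)))) =
      (\<Prod>h\<in>set H. ?g (card (hook_points ((!) \<pi>) {..<length \<pi>} (set H) h)))"
    by (rule prod.reindex_bij_betw[OF nth])
  finally show ?thesis
    by (simp add: config_weight_def)
qed

lemma VHC_sum:
  assumes "distinct \<pi>"
  shows "(\<Sum>H\<in>VHC \<pi>. GF_seq T r f (color_counts \<pi> H)) =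
    hook_sum (GF T r f) ((!) \<pi>) {..<length \<pi>}"
  unfolding hook_sum_def
  by (subst sum.reindex_bij_betw[OF VHC_bij[OF assms], symmetric]) (simp add: GF_seq_color_counts)

theorem theorem4p5:
  fixes black white :: "'c::finite"
    and T :: "'c tree set"
    and r :: nat
    and f :: "nat \<Rightarrow> 'c tree \<Rightarrow> complex"
    and \<pi> :: "nat list"
  assumes "black \<noteq> white"
    and "troupe black T"
    and "\<And>i. i \<in> {1..r} \<Longrightarrow> insertion_additive black (f i)"
    and "is_perm \<pi>"
  shows "(\<Sum>t\<in>{t\<in>decreasing_over T. postorder_reading t = \<pi>}. \<Prod>i=1..r. xpow i (ddot (f i) t))
       = (\<Sum>H\<in>VHC \<pi>. GF_seq T r f (color_counts \<pi> H))"
proof -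
  have "distinct \<pi>"
    using assms(4) by (simp add: is_perm_def)
  moreover from this have "inj_on ((!) \<pi>) {..<length \<pi>}"
    by (simp add: inj_on_nth)
  ultimately show ?thesis
    using tree_sum_eq_hook_sum[of black T r f "{..<length \<pi>}" "(!) \<pi>"] assms(2,3)
    by (simp only: postorder_fiber_sum[OF assms(4)] VHC_sum finite_lessThan)
qed

end
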